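(* Let $0\le\kappa<1$ and $Q\in\mathbb R$, $Q\neq0$. Let $\Theta$ be a minimal $L$-system with one-dimensional input-output space $\mathbb C$ and $J=1$ whose impedance function $V_\Theta(z)$ belongs to the class $\mathfrak M^Q_\kappa$. Let $\Theta_\alpha$, $\alpha\in[0,\pi)$, be a non-trivial ($\alpha\neq\pi/2$) unimodular transformation of $\Theta$. Then $V_{\Theta_\alpha}(z)\in\mathfrak M^{-Q}_\kappa$ if and only if $$\tan\alpha=\frac{b}{2Q},\qquad\text{where}\quad b=Q^2+a^2-1\quad\text{and}\quad a=\frac{1-\kappa}{1+\kappa}.$$
   Context: $[X,Y]$ denotes the bounded linear operators from $X$ to $Y$; $\mathrm{Im}\,S=(S-S^* )/(2i)$, $\mathrm{Re}\,S=(S+S^* )/2$. **$L$-system with one-dimensional input-output.** Let $\dot A$ be a closed, densely defined symmetric operator with finite equal deficiency indices in a Hilbert space $\mathcal H$. Let $\mathcal H_+=\mathrm{Dom}(\dot A^* )$ with inner product $(f,g)_+=(f,g)+(\dot A^*f,\dot A^*g)$, and let $\mathcal H_+\subset\mathcal H\subset\mathcal H_-$ be the corresponding rigged Hilbert space ($\mathcal H_-$ is dual to $\mathcal H_+$ with respect to the pairing extending the inner product of $\mathcal H$), with the conjugate of $\mathcal H_\pm$ identified with $\mathcal H_\mp$. A quasi-self-adjoint extension of $\dot A$ is a non-symmetric operator $T$ with $\dot A\subset T\subset\dot A^*$; it belongs to $\Lambda(\dot A)$ if $\rho(T)\ne\emptyset$ and $\mathrm{Dom}(\dot A)=\mathrm{Dom}(T)\cap\mathrm{Dom}(T^*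 )$. An operator $\mathbb A\in[\mathcal H_+,\mathcal H_-]$ is a $( * )$-extension of $T$ if $\mathbb A\supset T\supset\dot A$, $\mathbb A^*\supset T^*\supset\dot A$, and the quasi-kernel $\hat A$ of $\mathrm{Re}\,\mathbb A$, i.e. the restriction of $\mathrm{Re}\,\mathbb A$ to $\{f\in\mathcal H_+:\mathrm{Re}\,\mathbb A f\in\mathcal H\}$, is self-adjoint in $\mathcal H$. An $L$-system with $E=\mathbb C$, $J=1$, $$\Theta=\begin{pmatrix}\mathbb A&K&1\\ \mathcal H_+\subset\mathcal H\subset\mathcal H_-&&\mathbb C\end{pmatrix},$$ consists of a $( * )$-extension $\mathbb A$ of some $T\in\Lambda(\dot A)$ (the main operator) and $K\in[\mathbb C,\mathcal H_-]$ with $\mathrm{Im}\,\mathbb A=KK^*$ and $\mathrm{Ran}(K)=\mathrm{Ran}(\mathrm{Im}\,\mathbb A)$. It is minimal if $\dot A$ is prime, i.e. there is no non-trivial reducing subspace of $\mathcal H$ on which $\dot A$ induces a self-adjoint operator. Its transfer function is $W_\Theta(z)=1-2iK^*(\mathbb A-zI)^{-1}K$, $z\in\rho(T)$, and its impedance function is $V_\Theta(z)=K^*(\mathrm{Re}\,\mathbb A-zI)^{-1}K$, $z\in\rho(\hat A)$ (both are known to be well defined, and $V_\Theta=i(W_\Theta-1)/(W_\Theta+1)$ for $\mathrm{Im}\,z\ne0$, $z\in\rho(T)$). **Unimodular transformation.** For $\alpha\in[0,\pi)$, an $L$-system with $E=\mathbb C$, $J=1$, $$\Theta_\alpha=\begin{pmatrix}\mathbb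 A_\alpha&K_\alpha&1\\ \mathcal H_+^{(\alpha)}\subset\mathcal H^{(\alpha)}\subset\mathcal H_-^{(\alpha)}&&\mathbb C\end{pmatrix}$$ (that is, $\mathcal H_+^{(\alpha)}\subset\mathcal H^{(\alpha)}\subset\mathcal H_-^{(\alpha)}$ is the rigged Hilbert space with $\mathcal H_+^{(\alpha)}=\mathrm{Dom}(\dot A_\alpha^* )$ for a closed, densely defined symmetric operator $\dot A_\alpha$ with finite equal deficiency indices in $\mathcal H^{(\alpha)}$, $\mathbb A_\alpha$ is a $( * )$-extension of some $T_\alpha\in\Lambda(\dot A_\alpha)$, and $K_\alpha\in[\mathbb C,\mathcal H_-^{(\alpha)}]$ with $\mathrm{Im}\,\mathbb A_\alpha=K_\alpha K_\alpha^*$ and $\mathrm{Ran}(K_\alpha)=\mathrm{Ran}(\mathrm{Im}\,\mathbb A_\alpha)$), with transfer function $W_{\Theta_\alpha}(z)=1-2iK_\alpha^*(\mathbb A_\alpha-zI)^{-1}K_\alpha$ and impedance function $V_{\Theta_\alpha}(z)=K_\alpha^*(\mathrm{Re}\,\mathbb A_\alpha-zI)^{-1}K_\alpha$, is a unimodular transformation of $\Theta$ if $W_{\Theta_\alpha}(z)=W_\Theta(z)\cdot(-e^{2i\alpha})$. The case $\alpha=\pi/2$ is the trivial one. **Class $\mathfrak M^Q_\kappa$** ($Q\in\mathbb R$, $0\le\kappa<1$): scalar Herglotz–Nevanlinna functions $V$ (analytic maps of $\mathbb C_+$ into itself) admitting the representation $$V(z)=Q+\int_{\mathbb R}\left(\frac1{\lambda-z}-\frac{\lambda}{1+\lambda^2}\right)d\mu(\lambda),$$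 where $\mu$ is an infinite Borel measure with $\int_{\mathbb R}\frac{d\mu(\lambda)}{1+\lambda^2}=\frac{1-\kappa}{1+\kappa}$. *)

theory Defs
  imports "HOL-Analysis.Analysis"
begin

(* Complex Hilbert spaces; the inner product is linear in its first argument. *)

class chilbert_space = banach +
  fixes scaleC :: "complex \<Rightarrow> 'a \<Rightarrow> 'a" (infixr "*\<^sub>C" 75)
    and cinner :: "'a \<Rightarrow> 'a \<Rightarrow> complex"
  assumes scaleC_add_right: "c *\<^sub>C (x + y) = c *\<^sub>C x + c *\<^sub>C y"
    and scaleC_add_left: "(c + d) *\<^sub>C x = c *\<^sub>C x + d *\<^sub>C x"
    and scaleC_scaleC: "c *\<^sub>C d *\<^sub>C x = (c * d) *\<^sub>C x"
    and scaleR_scaleC: "r *\<^sub>R x = complex_of_real r *\<^sub>C x"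
    and cinner_commute: "cinner x y = cnj (cinner y x)"
    and cinner_add_left: "cinner (x + y) z = cinner x z + cinner y z"
    and cinner_scaleC_left: "cinner (c *\<^sub>C x) y = c * cinner x y"
    and cinner_self: "cinner x x = complex_of_real ((norm x)\<^sup>2)"

lemma scaleC_one: "1 *\<^sub>C x = (x :: 'a::chilbert_space)"
  using scaleR_scaleC[of 1 x] by simp

global_interpretation cvec: vector_space "scaleC :: complex \<Rightarrow> 'a::chilbert_space \<Rightarrow> 'a"
  by standard (simp_all add: scaleC_add_right scaleC_add_left scaleC_scaleC scaleC_one)

instantiation prod :: (chilbert_space, chilbert_space) chilbert_space
begin

definition "c *\<^sub>C p = (c *\<^sub>C fst p, c *\<^sub>C snd p)"

definition "cinner p q = cinner (fst p) (fst q) + cinner (snd p) (snd q)"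

instance
proof
  fix x y z :: "'a \<times> 'b" and c d :: complex and r :: real
  show "cinner x y = cnj (cinner y x)"
    unfolding cinner_prod_def complex_cnj_add
    using cinner_commute[of "fst x" "fst y"] cinner_commute[of "snd x" "snd y"] by simp
  show "cinner x x = complex_of_real ((norm x)\<^sup>2)"
    by (simp add: cinner_prod_def cinner_self norm_prod_def)
qed (simp_all add: scaleC_prod_def cinner_prod_def scaleC_add_right scaleC_add_left scaleC_scaleC
      scaleR_prod_def scaleR_scaleC cinner_add_left cinner_scaleC_left algebra_simps)

end

(* Unbounded operators are represented by their graphs, so that inclusion of operators is
   set inclusion and the domain of an operator is the library constant Domain. *)

definition lin_operator :: "('a::chilbert_space \<times> 'a) set \<Rightarrow> bool" where
  "lin_operator A \<longleftrightarrow> cvec.subspace A \<and> single_valued A"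

definition op_apply :: "('a \<times> 'a) set \<Rightarrow> 'a \<Rightarrow> 'a" where
  "op_apply A f = (THE g. (f, g) \<in> A)"

definition densely_defined :: "('a::chilbert_space \<times> 'a) set \<Rightarrow> bool" where
  "densely_defined A \<longleftrightarrow> closure (Domain A) = UNIV"

definition adjoint_in :: "'a::chilbert_space set \<Rightarrow> ('a \<times> 'a) set \<Rightarrow> ('a \<times> 'a) set" where
  "adjoint_in M A = {(g, h). g \<in> M \<and> h \<in> M \<and> (\<forall>(f, k) \<in> A. cinner k g = cinner f h)}"

abbreviation op_adjoint :: "('a::chilbert_space \<times> 'a) set \<Rightarrow> ('a \<times> 'a) set" where
  "op_adjoint \<equiv> adjoint_in UNIV"

definition symmetric_op :: "('a::chilbert_space \<times> 'a) set \<Rightarrow> bool" where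
  "symmetric_op A \<longleftrightarrow> A \<subseteq> op_adjoint A"

(* self-adjointness of an operator acting in the closed subspace M *)
definition self_adjoint_in :: "'a::chilbert_space set \<Rightarrow> ('a \<times> 'a) set \<Rightarrow> bool" where
  "self_adjoint_in M A \<longleftrightarrow>
     lin_operator A \<and> A \<subseteq> M \<times> M \<and> M \<subseteq> closure (Domain A) \<and> adjoint_in M A = A"

abbreviation self_adjoint_op :: "('a::chilbert_space \<times> 'a) set \<Rightarrow> bool" where
  "self_adjoint_op \<equiv> self_adjoint_in UNIV"

(* z is in the resolvent set of T if T - zI is a bijection of its domain onto the whole
   space and has a bounded inverse *)
definition resolvent_set :: "('a::chilbert_space \<times> 'a) set \<Rightarrow> complex set" where
  "resolvent_set T = {z. (\<forall>g. \<exists>!f. (f, g + z *\<^sub>C f) \<in> T) \<and>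
     (\<exists>C. \<forall>(f, h) \<in> T. norm f \<le> C * norm (h - z *\<^sub>C f))}"

definition deficiency_space :: "('a::chilbert_space \<times> 'a) set \<Rightarrow> complex \<Rightarrow> 'a set" where
  "deficiency_space A z = {f. (f, z *\<^sub>C f) \<in> op_adjoint A}"

definition finite_dim :: "'a::chilbert_space set \<Rightarrow> bool" where
  "finite_dim S \<longleftrightarrow> (\<exists>B. finite B \<and> cvec.span B = S)"

definition finite_equal_deficiency :: "('a::chilbert_space \<times> 'a) set \<Rightarrow> bool" where
  "finite_equal_deficiency A \<longleftrightarrow>
     finite_dim (deficiency_space A \<i>) \<and> finite_dim (deficiency_space A (- \<i>)) \<and>
     cvec.dim (deficiency_space A \<i>) = cvec.dim (deficiency_space A (- \<i>))"

definition admissible_symmetric :: "('a::chilbert_space \<times> 'a) set \<Rightarrow> bool" where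
  "admissible_symmetric A \<longleftrightarrow>
     lin_operator A \<and> closed A \<and> densely_defined A \<and> symmetric_op A \<and> finite_equal_deficiency A"

definition orth_proj :: "'a::chilbert_space set \<Rightarrow> 'a \<Rightarrow> 'a" where
  "orth_proj M f = (THE g. g \<in> M \<and> (\<forall>m \<in> M. cinner (f - g) m = 0))"

definition reducing_subspace :: "('a::chilbert_space \<times> 'a) set \<Rightarrow> 'a set \<Rightarrow> bool" where
  "reducing_subspace A M \<longleftrightarrow> cvec.subspace M \<and> closed M \<and>
     (\<forall>(f, g) \<in> A. (orth_proj M f, orth_proj M g) \<in> A)"

definition prime_operator :: "('a::chilbert_space \<times> 'a) set \<Rightarrow> bool" where
  "prime_operator A \<longleftrightarrow>
     \<not> (\<exists>M. reducing_subspace A M \<and> M \<noteq> {0} \<and> self_adjoint_in M (A \<inter> M \<times> M))"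

(* The rigged Hilbert space generated by A.  H_- is realised as the space of bounded
   conjugate-linear functionals on H_+, extended by 0 outside H_+: phi f is the pairing
   (phi, f), and its conjugate is (f, phi).  An element g of H is identified with the
   functional (g, .), which is the map embed_minus. *)

definition Hplus :: "('a::chilbert_space \<times> 'a) set \<Rightarrow> 'a set" where
  "Hplus A = Domain (op_adjoint A)"

definition plus_inner :: "('a::chilbert_space \<times> 'a) set \<Rightarrow> 'a \<Rightarrow> 'a \<Rightarrow> complex" where
  "plus_inner A f g =
     cinner f g + cinner (op_apply (op_adjoint A) f) (op_apply (op_adjoint A) g)"

definition plus_norm :: "('a::chilbert_space \<times> 'a) set \<Rightarrow> 'a \<Rightarrow> real" where
  "plus_norm A f = sqrt (Re (plus_inner A f f))"

definition Hminus :: "('a::chilbert_space \<times> 'a) set \<Rightarrow> ('a \<Rightarrow> complex) set" where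
  "Hminus A = {\<phi>.
     (\<forall>f \<in> Hplus A. \<forall>g \<in> Hplus A. \<forall>c. \<phi> (c *\<^sub>C f + g) = cnj c * \<phi> f + \<phi> g) \<and>
     (\<exists>C. \<forall>f \<in> Hplus A. cmod (\<phi> f) \<le> C * plus_norm A f) \<and>
     (\<forall>f. f \<notin> Hplus A \<longrightarrow> \<phi> f = 0)}"

definition minus_norm :: "('a::chilbert_space \<times> 'a) set \<Rightarrow> ('a \<Rightarrow> complex) \<Rightarrow> real" where
  "minus_norm A \<phi> = (SUP f \<in> {f \<in> Hplus A. plus_norm A f \<le> 1}. cmod (\<phi> f))"

definition embed_minus :: "('a::chilbert_space \<times> 'a) set \<Rightarrow> 'a \<Rightarrow> 'a \<Rightarrow> complex" where
  "embed_minus A g = (\<lambda>f. if f \<in> Hplus A then cinner g f else 0)"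

(* [H_+, H_-]; values outside H_+ are irrelevant *)
definition bounded_plus_minus ::
    "('a::chilbert_space \<times> 'a) set \<Rightarrow> ('a \<Rightarrow> 'a \<Rightarrow> complex) \<Rightarrow> bool" where
  "bounded_plus_minus A S \<longleftrightarrow>
     (\<forall>f \<in> Hplus A. S f \<in> Hminus A) \<and>
     (\<forall>f \<in> Hplus A. \<forall>g \<in> Hplus A. \<forall>c. S (c *\<^sub>C f + g) = (\<lambda>h. c * S f h + S g h)) \<and>
     (\<exists>C. \<forall>f \<in> Hplus A. minus_norm A (S f) \<le> C * plus_norm A f)"

(* [C, H_-] *)
definition bounded_C_minus ::
    "('a::chilbert_space \<times> 'a) set \<Rightarrow> (complex \<Rightarrow> 'a \<Rightarrow> complex) \<Rightarrow> bool" where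
  "bounded_C_minus A K \<longleftrightarrow>
     (\<forall>c. K c \<in> Hminus A) \<and>
     (\<forall>a b c. K (c * a + b) = (\<lambda>h. c * K a h + K b h)) \<and>
     (\<exists>C. \<forall>c. minus_norm A (K c) \<le> C * cmod c)"

(* S* in [H_+, H_-] is determined by (S f, g) = (f, S* g) for f, g in H_+ *)
definition pm_adjoint ::
    "('a::chilbert_space \<times> 'a) set \<Rightarrow> ('a \<Rightarrow> 'a \<Rightarrow> complex) \<Rightarrow> 'a \<Rightarrow> 'a \<Rightarrow> complex" where
  "pm_adjoint A S g = (\<lambda>f. if f \<in> Hplus A then cnj (S f g) else 0)"

definition pm_Re ::
    "('a::chilbert_space \<times> 'a) set \<Rightarrow> ('a \<Rightarrow> 'a \<Rightarrow> complex) \<Rightarrow> 'a \<Rightarrow> 'a \<Rightarrow> complex" where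
  "pm_Re A S f = (\<lambda>h. (S f h + pm_adjoint A S f h) / 2)"

definition pm_Im ::
    "('a::chilbert_space \<times> 'a) set \<Rightarrow> ('a \<Rightarrow> 'a \<Rightarrow> complex) \<Rightarrow> 'a \<Rightarrow> 'a \<Rightarrow> complex" where
  "pm_Im A S f = (\<lambda>h. (S f h - pm_adjoint A S f h) / (2 * \<i>))"

(* K* : H_+ -> C *)
definition C_adjoint :: "(complex \<Rightarrow> 'a \<Rightarrow> complex) \<Rightarrow> 'a \<Rightarrow> complex" where
  "C_adjoint K f = cnj (K 1 f)"

lemma C_adjoint_pairing:
  assumes "bounded_C_minus A K"
  shows "K c f = c * cnj (C_adjoint K f)"
proof -
  have lin: "K (c * a + b) = (\<lambda>h. c * K a h + K b h)" for a b c
    using assms by (simp add: bounded_C_minus_def)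
  have "K 0 f = 0" using lin[of 1 0 0] by (simp add: fun_eq_iff)
  then show ?thesis using lin[of c 1 0] by (simp add: C_adjoint_def)
qed

definition pm_extends ::
    "('a::chilbert_space \<times> 'a) set \<Rightarrow> ('a \<Rightarrow> 'a \<Rightarrow> complex) \<Rightarrow> ('a \<times> 'a) set \<Rightarrow> bool" where
  "pm_extends A S T \<longleftrightarrow> (\<forall>(f, g) \<in> T. f \<in> Hplus A \<and> S f = embed_minus A g)"

definition quasi_kernel ::
    "('a::chilbert_space \<times> 'a) set \<Rightarrow> ('a \<Rightarrow> 'a \<Rightarrow> complex) \<Rightarrow> ('a \<times> 'a) set" where
  "quasi_kernel A S = {(f, g). f \<in> Hplus A \<and> S f = embed_minus A g}"

definition quasi_self_adjoint_ext ::
    "('a::chilbert_space \<times> 'a) set \<Rightarrow> ('a \<times> 'a) set \<Rightarrow> bool" where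
  "quasi_self_adjoint_ext A T \<longleftrightarrow>
     lin_operator T \<and> \<not> symmetric_op T \<and> A \<subseteq> T \<and> T \<subseteq> op_adjoint A"

definition class_Lambda :: "('a::chilbert_space \<times> 'a) set \<Rightarrow> ('a \<times> 'a) set set" where
  "class_Lambda A = {T. quasi_self_adjoint_ext A T \<and> resolvent_set T \<noteq> {} \<and>
     Domain A = Domain T \<inter> Domain (op_adjoint T)}"

definition star_extension ::
    "('a::chilbert_space \<times> 'a) set \<Rightarrow> ('a \<times> 'a) set \<Rightarrow> ('a \<Rightarrow> 'a \<Rightarrow> complex) \<Rightarrow> bool" where
  "star_extension A T S \<longleftrightarrow>
     bounded_plus_minus A S \<and>
     pm_extends A S T \<and> T \<supseteq> A \<and>
     pm_extends A (pm_adjoint A S) (op_adjoint T) \<and> op_adjoint T \<supseteq> A \<and>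
     self_adjoint_op (quasi_kernel A (pm_Re A S))"

record 'a l_system =
  symm_op :: "('a \<times> 'a) set"
  main_op :: "('a \<times> 'a) set"
  state_op :: "'a \<Rightarrow> 'a \<Rightarrow> complex"
  channel_op :: "complex \<Rightarrow> 'a \<Rightarrow> complex"

(* L-systems with input-output space C and J = 1 *)
definition is_L_system :: "('a::chilbert_space) l_system \<Rightarrow> bool" where
  "is_L_system \<Theta> \<longleftrightarrow>
     admissible_symmetric (symm_op \<Theta>) \<and>
     main_op \<Theta> \<in> class_Lambda (symm_op \<Theta>) \<and>
     star_extension (symm_op \<Theta>) (main_op \<Theta>) (state_op \<Theta>) \<and>
     bounded_C_minus (symm_op \<Theta>) (channel_op \<Theta>) \<and>
     (\<forall>f \<in> Hplus (symm_op \<Theta>).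
        pm_Im (symm_op \<Theta>) (state_op \<Theta>) f = channel_op \<Theta> (C_adjoint (channel_op \<Theta>) f)) \<and>
     range (channel_op \<Theta>) = pm_Im (symm_op \<Theta>) (state_op \<Theta>) ` Hplus (symm_op \<Theta>)"

definition minimal_L_system :: "('a::chilbert_space) l_system \<Rightarrow> bool" where
  "minimal_L_system \<Theta> \<longleftrightarrow> is_L_system \<Theta> \<and> prime_operator (symm_op \<Theta>)"

(* (S - zI)^{-1} : range of S - zI in H_- -> H_+ *)
definition pm_inverse ::
    "('a::chilbert_space \<times> 'a) set \<Rightarrow> ('a \<Rightarrow> 'a \<Rightarrow> complex) \<Rightarrow> complex \<Rightarrow> ('a \<Rightarrow> complex) \<Rightarrow> 'a"
  where "pm_inverse A S z \<phi> =
     (THE f. f \<in> Hplus A \<and> (\<lambda>h. S f h - z * embed_minus A f h) = \<phi>)"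

(* Operators on the one-dimensional space C are identified with their values at 1.  The
   transfer function is meaningful for z in resolvent_set (main_op Theta), the impedance
   function for z in the resolvent set of the quasi-kernel, which contains all non-real z. *)

definition transfer_fun :: "('a::chilbert_space) l_system \<Rightarrow> complex \<Rightarrow> complex" where
  "transfer_fun \<Theta> z = 1 - 2 * \<i> * C_adjoint (channel_op \<Theta>)
     (pm_inverse (symm_op \<Theta>) (state_op \<Theta>) z (channel_op \<Theta> 1))"

definition impedance_fun :: "('a::chilbert_space) l_system \<Rightarrow> complex \<Rightarrow> complex" where
  "impedance_fun \<Theta> z = C_adjoint (channel_op \<Theta>)
     (pm_inverse (symm_op \<Theta>) (pm_Re (symm_op \<Theta>) (state_op \<Theta>)) z (channel_op \<Theta> 1))"

(* The two systems may act in different Hilbert spaces; their transfer functions are compared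
   where both are defined. *)
definition unimodular_transformation ::
    "real \<Rightarrow> ('a::chilbert_space) l_system \<Rightarrow> ('b::chilbert_space) l_system \<Rightarrow> bool" where
  "unimodular_transformation \<alpha> \<Theta> \<Theta>\<^sub>\<alpha> \<longleftrightarrow>
     0 \<le> \<alpha> \<and> \<alpha> < pi \<and> is_L_system \<Theta>\<^sub>\<alpha> \<and>
     (\<forall>z \<in> resolvent_set (main_op \<Theta>) \<inter> resolvent_set (main_op \<Theta>\<^sub>\<alpha>).
        transfer_fun \<Theta>\<^sub>\<alpha> z = transfer_fun \<Theta> z * (- exp (2 * \<i> * complex_of_real \<alpha>)))"

definition herglotz_nevanlinna :: "(complex \<Rightarrow> complex) \<Rightarrow> bool" where
  "herglotz_nevanlinna V \<longleftrightarrow>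
     V holomorphic_on {z. Im z > 0} \<and> (\<forall>z. Im z > 0 \<longrightarrow> Im (V z) > 0)"

definition class_MQ :: "real \<Rightarrow> real \<Rightarrow> (complex \<Rightarrow> complex) set" where
  "class_MQ Q \<kappa> = {V. herglotz_nevanlinna V \<and>
     (\<exists>\<mu> :: real measure. sets \<mu> = sets borel \<and> emeasure \<mu> UNIV = \<infinity> \<and>
        (\<integral>\<^sup>+ x. ennreal (1 / (1 + x\<^sup>2)) \<partial>\<mu>) = ennreal ((1 - \<kappa>) / (1 + \<kappa>)) \<and>
        (\<forall>z. Im z > 0 \<longrightarrow> V z = complex_of_real Q +
           (\<integral>x. (1 / (complex_of_real x - z) - complex_of_real (x / (1 + x\<^sup>2))) \<partial>\<mu>)))}"

end

theory Submission
  imports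
    Defs
    "HOL-Complex_Analysis.Cauchy_Integral_Formula"
    "HOL-Probability.Helly_Selection"
begin

text \<open>
  Put \<open>t = tan \<alpha>\<close>. The relation between a transfer function \<open>W\<close> and its impedance function \<open>V\<close>
  is \<open>W = (1 - \<i> V) / (1 + \<i> V)\<close>, so multiplying \<open>W\<close> by \<open>- exp (2 \<i> \<alpha>)\<close> turns \<open>V\<close> into
  \<open>V' = (1 + t V) / (t - V)\<close> (\<open>impedance_unimodular_transformation\<close>). A function of the class
  with parameters \<open>Q\<close> and \<open>\<kappa>\<close> has the value \<open>Q + \<i> a\<close> at \<open>\<i>\<close>, because the kernel of the integral
  representation is \<open>\<i> / (1 + x\<^sup>2)\<close> there (\<open>class_MQ_at_i\<close>). The transformed function takes the value
  \<open>- Q + \<i> a\<close> at \<open>\<i>\<close> exactly when \<open>2 Q t = Q\<^sup>2 + a\<^sup>2 - 1\<close>. This settles necessity, and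
  it reduces sufficiency to the claim that a Moebius transformation of this kind that preserves the
  imaginary part at \<open>\<i>\<close> does not lead out of the classes (\<open>Moebius_class_MQ\<close>).

  Two things carry the proof. On the operator side, the impedance and transfer functions have to be
  computed from their definitions. The imaginary part of the state-space operator has rank one,
  so both resolvents applied to the channel vector are multiples of one vector \<open>u\<close>, and the relation
  between \<open>W\<close> and \<open>V\<close> drops out. The two systems are compared in the lower half-plane, where the main
  operator has no spectrum (\<open>lower_half_plane_resolvent\<close>,
  \<open>transfer_lower_half_plane\<close>).

  On the function side, the transformed function needs an integral representation of its own. It is
  obtained from the classical theorem of Herglotz and Nevanlinna, proved here with the Schwarz formula on
  the disc, Helly's selection theorem and the Cayley map (\<open>Nevanlinna_representation\<close>). That its
  linear term vanishes and that its measure is infinite is read off from the growth along the imaginary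
  axis.
\<close>

section \<open>Complex Hilbert spaces and self-adjoint operators\<close>

lemma cinner_zero_left: "cinner 0 (x::'a::chilbert_space) = 0"
  using cinner_add_left[of 0 0 x] by simp

lemma cinner_add_right: "cinner (x::'a::chilbert_space) (y + z) = cinner x y + cinner x z"
  by (metis cinner_add_left cinner_commute complex_cnj_add)

lemma cinner_scaleC_right: "cinner (x::'a::chilbert_space) (c *\<^sub>C y) = cnj c * cinner x y"
  by (metis cinner_scaleC_left cinner_commute complex_cnj_mult)

lemma cinner_minus_left: "cinner (- x) (y::'a::chilbert_space) = - cinner x y"
  using cinner_add_left[of x "- x" y] by (simp add: cinner_zero_left eq_neg_iff_add_eq_0 add.commute)

lemma cinner_diff_left: "cinner (x - y) (z::'a::chilbert_space) = cinner x z - cinner y z"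
  using cinner_add_left[of x "- y" z] by (simp add: cinner_minus_left)

lemma cinner_minus_right: "cinner (x::'a::chilbert_space) (- y) = - cinner x y"
  by (metis cinner_minus_left cinner_commute complex_cnj_minus)

lemma cinner_diff_right: "cinner (x::'a::chilbert_space) (y - z) = cinner x y - cinner x z"
  using cinner_add_right[of x y "- z"] by (simp add: cinner_minus_right)

lemma cinner_self_eq_0: "cinner x x = 0 \<longleftrightarrow> x = (0::'a::chilbert_space)"
  by (simp add: cinner_self)

lemma norm_diff_squared:
  "(norm (x - y))\<^sup>2 = (norm x)\<^sup>2 - 2 * Re (cinner x y) + (norm (y::'a::chilbert_space))\<^sup>2"
proof -
  have "complex_of_real ((norm (x - y))\<^sup>2) = cinner (x - y) (x - y)"
    by (rule cinner_self [symmetric])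
  also have "\<dots> = cinner x x - (cinner x y + cnj (cinner x y)) + cinner y y"
    using cinner_commute[of y x] by (simp add: cinner_diff_left cinner_diff_right)
  also have "\<dots> = complex_of_real ((norm x)\<^sup>2 - 2 * Re (cinner x y) + (norm y)\<^sup>2)"
    by (simp add: cinner_self complex_add_cnj)
  finally show ?thesis
    using of_real_eq_iff by blast
qed

lemma norm_scaleC: "norm (c *\<^sub>C x) = cmod c * norm (x::'a::chilbert_space)"
proof -
  have "complex_of_real ((norm (c *\<^sub>C x))\<^sup>2) = (c * cnj c) * cinner x x"
    by (simp add: cinner_self [symmetric] cinner_scaleC_left cinner_scaleC_right del: of_real_power)
  also have "\<dots> = complex_of_real ((cmod c * norm x)\<^sup>2)"
    by (simp add: complex_norm_square [symmetric] cinner_self power_mult_distrib del: of_real_power)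
  finally have "(norm (c *\<^sub>C x))\<^sup>2 = (cmod c * norm x)\<^sup>2"
    using of_real_eq_iff by blast
  then show ?thesis by (simp add: power2_eq_iff_nonneg)
qed

lemma norm_diff_orthogonal_component:
  fixes x y :: "'a::chilbert_space"
  assumes "y \<noteq> 0"
  shows "(norm (x - (cinner x y / complex_of_real ((norm y)\<^sup>2)) *\<^sub>C y))\<^sup>2
         = (norm x)\<^sup>2 - (cmod (cinner x y))\<^sup>2 / (norm y)\<^sup>2"
proof -
  define c where "c = cinner x y / complex_of_real ((norm y)\<^sup>2)"
  have "cinner x (c *\<^sub>C y) = complex_of_real ((cmod (cinner x y))\<^sup>2 / (norm y)\<^sup>2)"
    using complex_norm_square[of "cinner x y"] by (simp add: c_def cinner_scaleC_right mult.commute)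
  moreover have "(norm (c *\<^sub>C y))\<^sup>2 = (cmod (cinner x y))\<^sup>2 / (norm y)\<^sup>2"
    using assms by (simp add: norm_scaleC c_def norm_divide power_divide power_mult_distrib norm_power)
       (simp add: field_simps power2_eq_square power4_eq_xxxx)
  ultimately show ?thesis
    unfolding c_def[symmetric] norm_diff_squared by simp
qed

lemma cinner_Cauchy_Schwarz: "cmod (cinner x y) \<le> norm x * norm (y::'a::chilbert_space)"
proof (cases "y = 0")
  case True
  then show ?thesis by (metis cinner_commute cinner_zero_left complex_cnj_zero mult_zero_right norm_zero order_refl)
next
  case False
  have "0 \<le> (norm x)\<^sup>2 - (cmod (cinner x y))\<^sup>2 / (norm y)\<^sup>2"
    using norm_diff_orthogonal_component[OF False, of x] by (metis zero_le_power2)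
  then have "(cmod (cinner x y))\<^sup>2 \<le> (norm x * norm y)\<^sup>2"
    using False by (simp add: field_simps power_mult_distrib)
  then show ?thesis by (simp add: power2_le_iff_abs_le)
qed

lemma bounded_bilinear_cinner: "bounded_bilinear (cinner :: 'a::chilbert_space \<Rightarrow> 'a \<Rightarrow> complex)"
proof
  show "\<exists>K. \<forall>a b. cmod (cinner (a::'a) b) \<le> norm a * norm b * K"
    using cinner_Cauchy_Schwarz by (metis mult.right_neutral)
qed (simp_all add: cinner_add_left cinner_add_right scaleR_scaleC cinner_scaleC_left cinner_scaleC_right
      scaleR_conv_of_real)

lemma bounded_bilinear_scaleC: "bounded_bilinear (scaleC :: complex \<Rightarrow> 'a::chilbert_space \<Rightarrow> 'a)"
proof
  show "\<exists>K. \<forall>a b. norm (scaleC a (b::'a)) \<le> norm a * norm b * K"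
    using norm_scaleC by (metis mult.right_neutral order_refl)
qed (simp_all add: scaleC_add_left scaleC_add_right scaleR_scaleC scaleC_scaleC scaleR_conv_of_real mult.commute)

lemmas tendsto_cinner [tendsto_intros] = bounded_bilinear.tendsto [OF bounded_bilinear_cinner]
lemmas tendsto_scaleC [tendsto_intros] = bounded_bilinear.tendsto [OF bounded_bilinear_scaleC]

text \<open>
  This is the projection theorem in the form of a separation statement: the distance from
  \<open>x\<close> to \<open>M\<close> is attained at some \<open>l\<close>, because the parallelogram law makes a
  minimising sequence Cauchy, and \<open>v = x - l\<close> does the job. Self-adjoint resolvents and biadjoints
  below both rest on it.
\<close>

lemma exists_orthogonal_vector:
  fixes M :: "'a::chilbert_space set"
  assumes M: "cvec.subspace M" "closed M" and x: "x \<notin> M"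
  obtains v where "\<And>m. m \<in> M \<Longrightarrow> cinner m v = 0" and "cinner x v \<noteq> 0"
proof -
  define d where "d = infdist x M"
  have M0: "M \<noteq> {}" using M(1) cvec.subspace_0 by blast
  have d_le: "d \<le> norm (x - m)" if "m \<in> M" for m
    using infdist_le[OF that, of x] by (simp add: d_def dist_norm)
  have "\<exists>m\<in>M. norm (x - m) < sqrt (d\<^sup>2 + 1 / Suc n)" for n
  proof -
    have "d < sqrt (d\<^sup>2 + 1 / Suc n)"
      by (rule real_less_rsqrt) simp
    then have "infdist x M < sqrt (d\<^sup>2 + 1 / Suc n)" by (simp add: d_def)
    then show ?thesis
      unfolding infdist_notempty[OF M0] dist_norm
      by (subst (asm) cInf_less_iff) (use M0 in \<open>auto intro: bdd_belowI[of _ 0]\<close>)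
  qed
  then obtain m where mM: "\<And>n. m n \<in> M" and m: "\<And>n. norm (x - m n) < sqrt (d\<^sup>2 + 1 / Suc n)"
    by metis
  have m2: "(norm (x - m n))\<^sup>2 \<le> d\<^sup>2 + 1 / Suc n" for n
  proof -
    have "(norm (x - m n))\<^sup>2 \<le> (sqrt (d\<^sup>2 + 1 / Suc n))\<^sup>2"
      using m[of n] by (intro power_mono) auto
    then show ?thesis by simp
  qed
  \<comment> \<open>The midpoint of two members of \<open>M\<close> is again at distance at least \<open>d\<close> from \<open>x\<close>.\<close>
  have par: "(norm (m j - m k))\<^sup>2 \<le> 2 / Suc j + 2 / Suc k" for j k
  proof -
    let ?p = "x - m j" and ?q = "x - m k"
    let ?h = "(1 / 2 :: complex) *\<^sub>C (m j + m k)"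
    have "?h \<in> M" using M(1) mM by (simp add: cvec.subspace_def)
    then have "d\<^sup>2 \<le> (norm (x - ?h))\<^sup>2"
      using d_le infdist_nonneg[of x M] by (simp add: d_def power_mono)
    also have "\<dots> = (norm (?p + ?q))\<^sup>2 / 4"
    proof -
      have "?p + ?q = 2 *\<^sub>C (x - ?h)"
      proof -
        have "2 *\<^sub>C (x - ?h) = (2::complex) *\<^sub>C x - (m j + m k)"
          by (simp add: cvec.scale_right_diff_distrib scaleC_scaleC scaleC_one)
        moreover have "(2::complex) *\<^sub>C x = x + x"
          using scaleC_add_left[of 1 1 x] by (simp add: scaleC_one)
        ultimately show ?thesis by simp
      qed
      then have "norm (?p + ?q) = 2 * norm (x - ?h)" by (simp add: norm_scaleC)
      then show ?thesis by (simp add: power_mult_distrib)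
    qed
    also have "(norm (?p + ?q))\<^sup>2 = 2 * (norm ?p)\<^sup>2 + 2 * (norm ?q)\<^sup>2 - (norm (?p - ?q))\<^sup>2"
      using norm_diff_squared[of ?p ?q] norm_diff_squared[of ?p "- ?q"]
      unfolding cinner_minus_right diff_minus_eq_add norm_minus_cancel by simp
    also have "norm (?p - ?q) = norm (m j - m k)" by (simp add: norm_minus_commute)
    finally have "4 * d\<^sup>2 \<le> 2 * (norm ?p)\<^sup>2 + 2 * (norm ?q)\<^sup>2 - (norm (m j - m k))\<^sup>2"
      by simp
    moreover have "2 / Suc j = 2 * (1 / Suc j)" "2 / Suc k = 2 * (1 / Suc k)" by simp_all
    ultimately show ?thesis using m2[of j] m2[of k] by linarith
  qed
  have "Cauchy m"
  proof (rule metric_CauchyI)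
    fix e :: real assume e: "e > 0"
    obtain N where N: "4 / e\<^sup>2 < real N" using reals_Archimedean2 by blast
    show "\<exists>N. \<forall>j\<ge>N. \<forall>k\<ge>N. dist (m j) (m k) < e"
    proof (intro exI allI impI)
      fix j k assume jk: "j \<ge> N" "k \<ge> N"
      have "real N > 0" using N e by (smt (verit) zero_le_divide_iff zero_le_power2)
      have "2 / Suc j \<le> 2 / real N" "2 / Suc k \<le> 2 / real N"
        using jk \<open>real N > 0\<close> by (auto intro!: divide_left_mono)
      then have "(norm (m j - m k))\<^sup>2 \<le> 4 / real N" using par[of j k] by simp
      also have "\<dots> < e\<^sup>2" using N e \<open>real N > 0\<close> by (simp add: field_simps)
      finally show "dist (m j) (m k) < e"
        using e by (simp add: dist_norm power2_less_imp_less)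
    qed
  qed
  then obtain l where l: "m \<longlonglongrightarrow> l"
    using Cauchy_convergent_iff convergent_def by blast
  have lM: "l \<in> M" by (rule closed_sequentially[OF M(2) mM l])
  define v where "v = x - l"
  have "(norm v)\<^sup>2 \<le> d\<^sup>2"
  proof (rule LIMSEQ_le)
    show "(\<lambda>n. (norm (x - m n))\<^sup>2) \<longlonglongrightarrow> (norm v)\<^sup>2"
      unfolding v_def by (intro tendsto_intros l)
    show "(\<lambda>n. d\<^sup>2 + 1 / Suc n) \<longlonglongrightarrow> d\<^sup>2"
      using tendsto_add[OF tendsto_const[of "d\<^sup>2"] LIMSEQ_inverse_real_of_nat]
      by (simp add: inverse_eq_divide)
    show "\<exists>N. \<forall>n\<ge>N. (norm (x - m n))\<^sup>2 \<le> d\<^sup>2 + 1 / Suc n" using m2 by blast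
  qed
  have orth: "cinner v k = 0" if k: "k \<in> M" for k
  proof (cases "k = 0")
    case True
    then show ?thesis by (metis cinner_commute cinner_zero_left complex_cnj_zero)
  next
    case False
    let ?c = "cinner v k / complex_of_real ((norm k)\<^sup>2)"
    have "l + ?c *\<^sub>C k \<in> M" using M(1) lM k by (simp add: cvec.subspace_def)
    then have "d \<le> norm (v - ?c *\<^sub>C k)" using d_le by (simp add: v_def algebra_simps)
    then have "d\<^sup>2 \<le> (norm (v - ?c *\<^sub>C k))\<^sup>2"
      using infdist_nonneg[of x M] by (simp add: d_def power_mono)
    then have "(cmod (cinner v k))\<^sup>2 / (norm k)\<^sup>2 \<le> 0"
      using norm_diff_orthogonal_component[OF False, of v] \<open>(norm v)\<^sup>2 \<le> d\<^sup>2\<close> by simp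
    then show ?thesis using False by (simp add: divide_le_0_iff)
  qed
  show thesis
  proof
    show "cinner k v = 0" if "k \<in> M" for k
      using orth[OF that] cinner_commute[of k v] by simp
    have "cinner x v = cinner v v"
      using orth[OF lM] cinner_commute[of l v] by (simp add: v_def cinner_diff_left)
    moreover have "v \<noteq> 0" using x lM by (auto simp: v_def)
    ultimately show "cinner x v \<noteq> 0" by (simp add: cinner_self_eq_0)
  qed
qed

lemma op_adjoint_iff:
  "(g, h) \<in> op_adjoint A \<longleftrightarrow> (\<forall>f k. (f, k) \<in> A \<longrightarrow> cinner k g = cinner f h)"
  by (auto simp: adjoint_in_def)

lemma closed_op_adjoint: "closed (op_adjoint A)"
  unfolding closed_sequential_limits
proof (intro allI impI)
  fix X l assume *: "(\<forall>n. X n \<in> op_adjoint A) \<and> X \<longlonglongrightarrow> l"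
  have lim: "(\<lambda>n. fst (X n)) \<longlonglongrightarrow> fst l" "(\<lambda>n. snd (X n)) \<longlonglongrightarrow> snd l"
    using * by (auto intro: tendsto_fst tendsto_snd)
  have "cinner k (fst l) = cinner f (snd l)" if "(f, k) \<in> A" for f k
  proof (rule LIMSEQ_unique)
    show "(\<lambda>n. cinner k (fst (X n))) \<longlonglongrightarrow> cinner k (fst l)" by (intro tendsto_intros lim)
    have "cinner k (fst (X n)) = cinner f (snd (X n))" for n
      using * that op_adjoint_iff by (metis prod.collapse)
    then show "(\<lambda>n. cinner k (fst (X n))) \<longlonglongrightarrow> cinner f (snd l)"
      by (simp add: tendsto_intros lim)
  qed
  then show "l \<in> op_adjoint A" using op_adjoint_iff by (metis prod.collapse)
qed

text \<open>
  The orthogonal complement of the graph of \<open>T\<close> in \<open>H \<times> H\<close> is the graph of the adjoint, turned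
  by \<open>(p, q) \<mapsto> (- q, p)\<close>. Separating \<open>(f, k)\<close> from the closed graph therefore produces an
  element of the adjoint that contradicts \<open>(f, k) \<in> T\<^sup>*\<^sup>*\<close>.
\<close>

lemma mem_double_adjoint_of_closed:
  fixes T :: "('a::chilbert_space \<times> 'a) set"
  assumes T: "cvec.subspace T" "closed T"
    and fk: "(f, k) \<in> op_adjoint (op_adjoint T)"
  shows "(f, k) \<in> T"
proof (rule ccontr)
  assume "(f, k) \<notin> T"
  then obtain v where v: "\<And>m. m \<in> T \<Longrightarrow> cinner m v = 0" and nz: "cinner (f, k) v \<noteq> 0"
    using exists_orthogonal_vector[OF T] by blast
  have "(- snd v, fst v) \<in> op_adjoint T"
    unfolding op_adjoint_iff
  proof (intro allI impI)
    fix g h assume "(g, h) \<in> T"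
    from v[OF this] show "cinner h (- snd v) = cinner g (fst v)"
      by (simp add: cinner_prod_def cinner_minus_right eq_neg_iff_add_eq_0 neg_eq_iff_add_eq_0 add.commute)
  qed
  then have "cinner (fst v) f = cinner (- snd v) k"
    using fk by (auto simp: op_adjoint_iff)
  then have "cinner f (fst v) = - cinner k (snd v)"
    by (metis cinner_commute cinner_minus_left complex_cnj_minus)
  with nz show False by (simp add: cinner_prod_def)
qed

text \<open>
  A bounded everywhere defined inverse of \<open>T - w\<close> sends the limit of \<open>(T - w) f\<^sub>n\<close> to the limit
  of \<open>f\<^sub>n\<close>.
\<close>

lemma closed_of_resolvent_point:
  fixes T :: "('a::chilbert_space \<times> 'a) set"
  assumes T: "cvec.subspace T" and w: "w \<in> resolvent_set T"
  shows "closed T"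
  unfolding closed_sequential_limits
proof (intro allI impI)
  fix X l assume *: "(\<forall>n. X n \<in> T) \<and> X \<longlonglongrightarrow> l"
  define f h where "f = fst l" and "h = snd l"
  have lim: "(\<lambda>n. fst (X n)) \<longlonglongrightarrow> f" "(\<lambda>n. snd (X n)) \<longlonglongrightarrow> h"
    using * by (auto simp: f_def h_def intro: tendsto_fst tendsto_snd)
  obtain f' where f': "(f', (h - w *\<^sub>C f) + w *\<^sub>C f') \<in> T"
    using w unfolding resolvent_set_def by blast
  obtain C where C: "\<And>f h. (f, h) \<in> T \<Longrightarrow> norm f \<le> C * norm (h - w *\<^sub>C f)"
    using w unfolding resolvent_set_def by fast
  have "norm (fst (X n) - f') \<le> C * norm (snd (X n) - w *\<^sub>C fst (X n) - (h - w *\<^sub>C f))" for n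
  proof -
    have "X n - (f', (h - w *\<^sub>C f) + w *\<^sub>C f') \<in> T"
      using * f' T by (intro cvec.subspace_diff) auto
    then have "(fst (X n) - f', snd (X n) - ((h - w *\<^sub>C f) + w *\<^sub>C f')) \<in> T"
      by (metis diff_Pair prod.collapse)
    from C[OF this] show ?thesis by (simp add: cvec.scale_right_diff_distrib algebra_simps)
  qed
  then have "\<forall>\<^sub>F n in sequentially.
      norm (fst (X n) - f') \<le> C * norm (snd (X n) - w *\<^sub>C fst (X n) - (h - w *\<^sub>C f))"
    by simp
  moreover have "(\<lambda>n. C * norm (snd (X n) - w *\<^sub>C fst (X n) - (h - w *\<^sub>C f))) \<longlonglongrightarrow> 0"
    using tendsto_mult[OF tendsto_const tendsto_norm[OF tendsto_diff[OF tendsto_diff[OF lim(2)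
            tendsto_scaleC[OF tendsto_const lim(1)]] tendsto_const]], of C w "h - w *\<^sub>C f"] by simp
  ultimately have "(\<lambda>n. fst (X n) - f') \<longlonglongrightarrow> 0"
    by (rule Lim_null_comparison)
  then have "(\<lambda>n. fst (X n)) \<longlonglongrightarrow> f'" by (simp add: LIM_zero_iff)
  then have "f' = f" using lim(1) LIMSEQ_unique by blast
  then show "l \<in> T" using f' by (simp add: f_def h_def)
qed

lemma self_adjoint_cinner_commute:
  assumes "self_adjoint_op B" "(f, h) \<in> B" "(g, k) \<in> B"
  shows "cinner h g = cinner f k"
proof -
  have "(g, k) \<in> op_adjoint B" using assms by (auto simp: self_adjoint_in_def)
  then show ?thesis using assms(2) by (simp add: op_adjoint_iff)
qed

lemma self_adjoint_eigenvector_zero: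
  assumes B: "self_adjoint_op B" and z: "Im z \<noteq> 0" and f: "(f, z *\<^sub>C f) \<in> B"
  shows "f = 0"
proof -
  have "z * cinner f f = cnj z * cinner f f"
    using self_adjoint_cinner_commute[OF B f f] by (simp add: cinner_scaleC_left cinner_scaleC_right)
  moreover have "z \<noteq> cnj z" using z by (simp add: complex_eq_iff)
  ultimately show ?thesis by (simp add: cinner_self_eq_0)
qed

lemma self_adjoint_lower_bound:
  assumes B: "self_adjoint_op B" and f: "(f, h) \<in> B"
  shows "\<bar>Im z\<bar> * norm f \<le> norm (h - z *\<^sub>C f)"
proof (cases "f = 0")
  case False
  have "cinner h f = cinner f h" using self_adjoint_cinner_commute[OF B f f] .
  then have "Im (cinner h f) = 0"
    using arg_cong[OF cinner_commute[of h f], of Im] by simp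
  then have "Im (cinner (h - z *\<^sub>C f) f) = - Im z * (norm f)\<^sup>2"
    by (simp add: cinner_diff_left cinner_scaleC_left cinner_self)
  then have "\<bar>Im z\<bar> * (norm f)\<^sup>2 \<le> cmod (cinner (h - z *\<^sub>C f) f)"
    using abs_Im_le_cmod[of "cinner (h - z *\<^sub>C f) f"] by (simp add: abs_mult)
  also have "\<dots> \<le> norm (h - z *\<^sub>C f) * norm f" by (rule cinner_Cauchy_Schwarz)
  finally show ?thesis using False by (simp add: power2_eq_square)
qed simp

text \<open>
  The lower bound \<open>\<bar>Im z\<bar> \<parallel>f\<parallel> \<le> \<parallel>(B - z) f\<parallel>\<close> and the closedness of an adjoint make the
  range of \<open>B - z\<close> closed. A vector orthogonal to it would be an eigenvector of \<open>B\<^sup>* = B\<close> for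
  the non-real eigenvalue \<open>cnj z\<close>, hence zero.
\<close>

lemma self_adjoint_shift_surjective:
  fixes B :: "('a::chilbert_space \<times> 'a) set"
  assumes B: "self_adjoint_op B" and z: "Im z \<noteq> 0"
  obtains f where "(f, h + z *\<^sub>C f) \<in> B"
proof -
  define R where "R = {h. \<exists>f. (f, h + z *\<^sub>C f) \<in> B}"
  have sub: "cvec.subspace B" and clo: "closed B"
    using B closed_op_adjoint[of B] by (auto simp: self_adjoint_in_def lin_operator_def)
  have Rsub: "cvec.subspace R"
    unfolding cvec.subspace_def
  proof (intro conjI ballI allI)
    show "0 \<in> R" using cvec.subspace_0[OF sub] unfolding R_def mem_Collect_eq by (intro exI[of _ 0]) (simp add: zero_prod_def)
    fix x assume "x \<in> R"
    then obtain f where f: "(f, x + z *\<^sub>C f) \<in> B" by (auto simp: R_def)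
    show "c *\<^sub>C x \<in> R" for c
    proof -
      have "c *\<^sub>C (f, x + z *\<^sub>C f) \<in> B" by (rule cvec.subspace_scale[OF sub f])
      then show ?thesis
        unfolding R_def mem_Collect_eq
        by (intro exI[of _ "c *\<^sub>C f"]) (simp add: scaleC_prod_def scaleC_add_right scaleC_scaleC mult.commute)
    qed
    fix y assume "y \<in> R"
    then obtain g where g: "(g, y + z *\<^sub>C g) \<in> B" by (auto simp: R_def)
    have "(f, x + z *\<^sub>C f) + (g, y + z *\<^sub>C g) \<in> B" by (rule cvec.subspace_add[OF sub f g])
    then show "x + y \<in> R"
      unfolding R_def mem_Collect_eq by (intro exI[of _ "f + g"]) (simp add: scaleC_add_right add_ac)
  qed
  have Rclo: "closed R"
    unfolding closed_sequential_limits
  proof (intro allI impI)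
    fix X l assume *: "(\<forall>n. X n \<in> R) \<and> X \<longlonglongrightarrow> l"
    then have "\<forall>n. \<exists>f. (f, X n + z *\<^sub>C f) \<in> B" by (simp add: R_def)
    then obtain F where F: "\<And>n. (F n, X n + z *\<^sub>C F n) \<in> B" by metis
    have est: "\<bar>Im z\<bar> * norm (F j - F k) \<le> norm (X j - X k)" for j k
    proof -
      have "(F j, X j + z *\<^sub>C F j) - (F k, X k + z *\<^sub>C F k) \<in> B"
        by (rule cvec.subspace_diff[OF sub F F])
      then have "(F j - F k, X j + z *\<^sub>C F j - (X k + z *\<^sub>C F k)) \<in> B" by simp
      from self_adjoint_lower_bound[OF B this, of z] show ?thesis
        by (simp add: cvec.scale_right_diff_distrib algebra_simps)
    qed
    have "Cauchy F"
    proof (rule metric_CauchyI)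
      fix e :: real assume "e > 0"
      moreover have "Cauchy X" using * LIMSEQ_imp_Cauchy by blast
      ultimately obtain N where N: "\<And>j k. j \<ge> N \<Longrightarrow> k \<ge> N \<Longrightarrow> dist (X j) (X k) < \<bar>Im z\<bar> * e"
        using z metric_CauchyD[of X "\<bar>Im z\<bar> * e"] by auto
      show "\<exists>N. \<forall>j\<ge>N. \<forall>k\<ge>N. dist (F j) (F k) < e"
      proof (intro exI allI impI)
        fix j k assume "j \<ge> N" "k \<ge> N"
        then have "\<bar>Im z\<bar> * norm (F j - F k) < \<bar>Im z\<bar> * e"
          using N est[of j k] by (metis dist_norm order_le_less_trans)
        then show "dist (F j) (F k) < e" using z by (simp add: dist_norm)
      qed
    qed
    then obtain f where f: "F \<longlonglongrightarrow> f" using Cauchy_convergent_iff convergent_def by blast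
    have "(\<lambda>n. (F n, X n + z *\<^sub>C F n)) \<longlonglongrightarrow> (f, l + z *\<^sub>C f)"
      using * f by (intro tendsto_Pair tendsto_intros) auto
    then have "(f, l + z *\<^sub>C f) \<in> B" by (rule closed_sequentially[OF clo F])
    then show "l \<in> R" by (auto simp: R_def)
  qed
  have "h \<in> R"
  proof (rule ccontr)
    assume "h \<notin> R"
    then obtain v where v: "\<And>m. m \<in> R \<Longrightarrow> cinner m v = 0" and nz: "cinner h v \<noteq> 0"
      using exists_orthogonal_vector[OF Rsub Rclo] by blast
    have "(v, cnj z *\<^sub>C v) \<in> op_adjoint B"
      unfolding op_adjoint_iff
    proof (intro allI impI)
      fix f k assume "(f, k) \<in> B"
      then have "k - z *\<^sub>C f \<in> R" unfolding R_def mem_Collect_eq by (intro exI[of _ f]) simp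
      from v[OF this] show "cinner k v = cinner f (cnj z *\<^sub>C v)"
        by (simp add: cinner_diff_left cinner_scaleC_left cinner_scaleC_right)
    qed
    then have "(v, cnj z *\<^sub>C v) \<in> B" using B by (simp add: self_adjoint_in_def)
    then have "v = 0" using self_adjoint_eigenvector_zero[OF B, of "cnj z"] z by simp
    then show False using nz cinner_commute[of h v] by (simp add: cinner_zero_left)
  qed
  then obtain f where "(f, h + z *\<^sub>C f) \<in> B" unfolding R_def by blast
  then show thesis by (rule that)
qed

section \<open>Resolvents of L-systems\<close>

lemma subspace_op_adjoint: "cvec.subspace (op_adjoint A)"
  unfolding cvec.subspace_def
proof (intro conjI ballI allI)
  show "0 \<in> op_adjoint A"
    by (simp add: zero_prod_def op_adjoint_iff) (metis cinner_commute cinner_zero_left complex_cnj_zero)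
  fix x y c assume x: "x \<in> op_adjoint A"
  show "c *\<^sub>C x \<in> op_adjoint A"
    using x by (cases x) (simp add: op_adjoint_iff scaleC_prod_def cinner_scaleC_right)
  assume y: "y \<in> op_adjoint A"
  show "x + y \<in> op_adjoint A"
    using x y by (cases x; cases y) (simp add: op_adjoint_iff cinner_add_right)
qed

lemma subspace_Hplus: "cvec.subspace (Hplus A)"
  unfolding cvec.subspace_def
proof (intro conjI ballI allI)
  note sub = subspace_op_adjoint[of A]
  show "0 \<in> Hplus A"
    using cvec.subspace_0[OF sub] unfolding Hplus_def zero_prod_def by blast
  fix x y c assume "x \<in> Hplus A"
  then obtain x' where x: "(x, x') \<in> op_adjoint A" unfolding Hplus_def by blast
  show "c *\<^sub>C x \<in> Hplus A"
    using cvec.subspace_scale[OF sub x, of c] unfolding Hplus_def scaleC_prod_def by auto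
  assume "y \<in> Hplus A"
  then obtain y' where y: "(y, y') \<in> op_adjoint A" unfolding Hplus_def by blast
  show "x + y \<in> Hplus A"
    using cvec.subspace_add[OF sub x y] unfolding Hplus_def by auto
qed

text \<open>
  In this locale \<open>H\<close> is the space with the plus norm, \<open>S\<close> the state-space
  operator, \<open>R\<close> its real part with self-adjoint quasi-kernel \<open>B\<close>, and \<open>k\<close> the functional
  \<open>K\<^sup>*\<close>. Operators into the dual space are used as sesquilinear forms on \<open>H\<close>, so that
  \<open>Im S = K K\<^sup>*\<close> becomes the rank-one identity
  \<open>S f h = R f h + \<i> * k f * cnj (k h)\<close>, from which everything about the
  transfer and impedance functions follows.
\<close>

locale L_system =
  fixes \<Theta> :: "'a::chilbert_space l_system"
  assumes is_L_system: "is_L_system \<Theta>"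
begin

abbreviation "H \<equiv> Hplus (symm_op \<Theta>)"
abbreviation "T \<equiv> main_op \<Theta>"
abbreviation "S \<equiv> state_op \<Theta>"
abbreviation "R \<equiv> pm_Re (symm_op \<Theta>) S"
abbreviation "B \<equiv> quasi_kernel (symm_op \<Theta>) R"
abbreviation "K \<equiv> channel_op \<Theta>"
abbreviation "k \<equiv> C_adjoint K"

lemmas H_closed =
  cvec.subspace_add[OF subspace_Hplus] cvec.subspace_scale[OF subspace_Hplus]
  cvec.subspace_diff[OF subspace_Hplus]

lemma T_props: "lin_operator T" "\<not> symmetric_op T" "resolvent_set T \<noteq> {}"
  using is_L_system by (auto simp: is_L_system_def class_Lambda_def quasi_self_adjoint_ext_def)

lemma self_adjoint_B: "self_adjoint_op B"
  using is_L_system by (simp add: is_L_system_def star_extension_def)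

lemma state_bounded: "bounded_plus_minus (symm_op \<Theta>) S"
  using is_L_system by (simp add: is_L_system_def star_extension_def)

lemma channel_bounded: "bounded_C_minus (symm_op \<Theta>) K"
  using is_L_system by (simp add: is_L_system_def)

lemma state_linear: "f \<in> H \<Longrightarrow> g \<in> H \<Longrightarrow> S (c *\<^sub>C f + g) h = c * S f h + S g h"
  using state_bounded by (simp add: bounded_plus_minus_def)

lemma state_outside: "f \<in> H \<Longrightarrow> h \<notin> H \<Longrightarrow> S f h = 0"
  using state_bounded by (auto simp: bounded_plus_minus_def Hminus_def)

lemma channel_outside: "h \<notin> H \<Longrightarrow> K c h = 0"
  using channel_bounded by (auto simp: bounded_C_minus_def Hminus_def)

lemma channel_one: "K 1 h = cnj (k h)"
  by (simp add: C_adjoint_def)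

lemma k_linear:
  assumes "f \<in> H" "g \<in> H"
  shows "k (c *\<^sub>C f + g) = c * k f + k g"
proof -
  have "K 1 (c *\<^sub>C f + g) = cnj c * K 1 f + K 1 g"
    using channel_bounded assms unfolding bounded_C_minus_def Hminus_def by blast
  then show ?thesis by (simp add: C_adjoint_def)
qed

lemma zero_in_H: "0 \<in> H"
  by (rule cvec.subspace_0[OF subspace_Hplus])

lemma k_scale: "f \<in> H \<Longrightarrow> k (c *\<^sub>C f) = c * k f"
  using k_linear[of f 0 c] k_linear[of 0 0 1] zero_in_H by (simp add: scaleC_one)

lemma R_eq: "f \<in> H \<Longrightarrow> h \<in> H \<Longrightarrow> R f h = (S f h + cnj (S h f)) / 2"
  by (simp add: pm_Re_def pm_adjoint_def)

lemma R_outside: "f \<in> H \<Longrightarrow> h \<notin> H \<Longrightarrow> R f h = 0"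
  by (simp add: pm_Re_def pm_adjoint_def state_outside)

lemma R_hermitian: "f \<in> H \<Longrightarrow> h \<in> H \<Longrightarrow> R h f = cnj (R f h)"
  by (simp add: R_eq)

lemma state_adjoint_gap:
  assumes "f \<in> H" "h \<in> H"
  shows "S f h - cnj (S h f) = 2 * \<i> * k f * cnj (k h)"
proof -
  have "pm_Im (symm_op \<Theta>) S f = K (k f)"
    using is_L_system assms(1) by (simp add: is_L_system_def)
  then have "pm_Im (symm_op \<Theta>) S f h = k f * cnj (k h)"
    using C_adjoint_pairing[OF channel_bounded] by simp
  then show ?thesis
    using assms by (simp add: pm_Im_def pm_adjoint_def field_simps)
qed

lemma state_eq: "f \<in> H \<Longrightarrow> h \<in> H \<Longrightarrow> S f h = R f h + \<i> * k f * cnj (k h)"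
  using state_adjoint_gap[of f h] by (simp add: R_eq field_simps)

lemma R_linear:
  assumes "f \<in> H" "g \<in> H"
  shows "R (c *\<^sub>C f + g) h = c * R f h + R g h"
proof (cases "h \<in> H")
  case True
  have R: "R f h = S f h - \<i> * k f * cnj (k h)" if "f \<in> H" for f
    using state_eq[OF that True] by simp
  show ?thesis
    unfolding R[OF assms(1)] R[OF assms(2)] R[OF cvec.subspace_add[OF subspace_Hplus
          cvec.subspace_scale[OF subspace_Hplus assms(1)] assms(2)]]
    by (simp add: assms state_linear k_linear ring_distribs)
qed (simp add: assms H_closed R_outside)

lemma R_scale: "f \<in> H \<Longrightarrow> R (c *\<^sub>C f) h = c * R f h"
  using R_linear[of f 0 c h] R_linear[of 0 0 1 h] zero_in_H by (simp add: scaleC_one)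

lemma R_diff: "f \<in> H \<Longrightarrow> g \<in> H \<Longrightarrow> R (f - g) h = R f h - R g h"
  using R_linear[of g f "- 1" h] by (simp add: cvec.scale_minus_left scaleC_one)

lemma state_diff: "f \<in> H \<Longrightarrow> g \<in> H \<Longrightarrow> S (f - g) h = S f h - S g h"
  using state_linear[of g f "- 1" h] by (simp add: cvec.scale_minus_left scaleC_one)

lemma mem_B_iff: "(f, g) \<in> B \<longleftrightarrow> f \<in> H \<and> (\<forall>h\<in>H. R f h = cinner g h)"
  by (auto simp: quasi_kernel_def embed_minus_def fun_eq_iff R_outside)

lemma state_on_T: "(f, g) \<in> T \<Longrightarrow> f \<in> H \<and> (\<forall>h\<in>H. S f h = cinner g h)"
  using is_L_system unfolding is_L_system_def star_extension_def pm_extends_def embed_minus_def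
  by fastforce

lemma state_adjoint_on_T_adjoint:
  assumes "(f, g) \<in> op_adjoint T"
  shows "f \<in> H \<and> (\<forall>h\<in>H. cnj (S h f) = cinner g h)"
proof -
  have "pm_extends (symm_op \<Theta>) (pm_adjoint (symm_op \<Theta>) S) (op_adjoint T)"
    using is_L_system by (simp add: is_L_system_def star_extension_def)
  then have "f \<in> H" and eq: "pm_adjoint (symm_op \<Theta>) S f = embed_minus (symm_op \<Theta>) g"
    using assms by (auto simp only: pm_extends_def)
  have "cnj (S h f) = cinner g h" if "h \<in> H" for h
    using fun_cong[OF eq, of h] that by (simp add: pm_adjoint_def embed_minus_def)
  with \<open>f \<in> H\<close> show ?thesis by blast
qed

text \<open>
  The main operator is the whole part of the state-space operator with values in the Hilbert
  space: such a pair \<open>(f, g)\<close> pairs correctly with the adjoint of \<open>T\<close>, hence lies in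
  \<open>T\<^sup>*\<^sup>*\<close>, and \<open>T\<close> is closed because its resolvent set is non-empty.
\<close>

lemma mem_T_of_state:
  assumes f: "f \<in> H" and g: "\<And>h. h \<in> H \<Longrightarrow> S f h = cinner g h"
  shows "(f, g) \<in> T"
proof -
  have sub: "cvec.subspace T" using T_props by (simp add: lin_operator_def)
  moreover have "closed T" using T_props closed_of_resolvent_point[OF sub] by blast
  moreover have "(f, g) \<in> op_adjoint (op_adjoint T)"
  proof (rule op_adjoint_iff[THEN iffD2], intro allI impI)
    fix p q assume "(p, q) \<in> op_adjoint T"
    then have "p \<in> H" and "cnj (S f p) = cinner q f"
      using state_adjoint_on_T_adjoint f by blast+
    then show "cinner q f = cinner p g"
      using g[of p] cinner_commute[of p g] by metis
  qed
  ultimately show ?thesis by (rule mem_double_adjoint_of_closed)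
qed

text \<open>
  If \<open>k\<close> vanished on the domain of \<open>T\<close>, the rank-one identity would make \<open>T\<close> symmetric.
\<close>

lemma exists_channel_nonzero: "\<exists>f g. (f, g) \<in> T \<and> k f \<noteq> 0"
proof (rule ccontr)
  assume "\<not> ?thesis"
  then have k0: "k f = 0" if "(f, g) \<in> T" for f g using that by blast
  have "(f, g) \<in> op_adjoint T" if fg: "(f, g) \<in> T" for f g
    unfolding op_adjoint_iff
  proof (intro allI impI)
    fix p q assume pq: "(p, q) \<in> T"
    note * = state_on_T[OF fg] state_on_T[OF pq]
    have "cinner q f = S p f" using * by simp
    also have "\<dots> = cnj (S f p)" using state_adjoint_gap[of p f] * k0[OF pq] by simp
    also have "\<dots> = cinner p g" using * cinner_commute[of p g] by simp
    finally show "cinner q f = cinner p g" .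
  qed
  then have "symmetric_op T" by (auto simp: symmetric_op_def)
  then show False using T_props by blast
qed

lemma R_shift_kernel:
  assumes "Im z \<noteq> 0" "f \<in> H" "\<And>h. h \<in> H \<Longrightarrow> R f h = z * cinner f h"
  shows "f = 0"
  using self_adjoint_eigenvector_zero[OF self_adjoint_B assms(1)] assms(2,3)
  by (simp add: mem_B_iff cinner_scaleC_left)

text \<open>
  The vector \<open>u = (Re S - z)\<^sup>-\<^sup>1 (K 1)\<close> is obtained from a single \<open>f\<close> in the domain of \<open>T\<close> with
  \<open>k f \<noteq> 0\<close>: there \<open>(R - z) f = (T - z) f - \<i> * k f * K 1\<close>, and the first summand lies in the
  Hilbert space, so it can be removed by solving \<open>(B - z) p = (T - z) f\<close>.
\<close>

lemma impedance_vector: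
  assumes z: "Im z \<noteq> 0"
  obtains u where "u \<in> H" and "\<And>h. h \<in> H \<Longrightarrow> R u h = z * cinner u h + cnj (k h)"
    and "impedance_fun \<Theta> z = k u"
proof -
  obtain f g where fg: "(f, g) \<in> T" and kf: "k f \<noteq> 0"
    using exists_channel_nonzero by blast
  have f: "f \<in> H" and Sf: "\<And>h. h \<in> H \<Longrightarrow> S f h = cinner g h"
    using state_on_T[OF fg] by auto
  obtain p where p: "(p, (g - z *\<^sub>C f) + z *\<^sub>C p) \<in> B"
    using self_adjoint_shift_surjective[OF self_adjoint_B z] .
  have pH: "p \<in> H" using p mem_B_iff by blast
  define u where "u = (\<i> / k f) *\<^sub>C (f - p)"
  have fp: "f - p \<in> H" using f pH by (intro H_closed)
  then have u: "u \<in> H" unfolding u_def by (rule H_closed)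
  have Ru: "R u h = z * cinner u h + cnj (k h)" if h: "h \<in> H" for h
  proof -
    have "R p h = cinner g h - z * cinner f h + z * cinner p h"
      using p h by (simp add: mem_B_iff cinner_add_left cinner_diff_left cinner_scaleC_left)
    moreover have "R f h = cinner g h - \<i> * k f * cnj (k h)"
      using state_eq[OF f h] Sf[OF h] by simp
    moreover have "R u h = \<i> / k f * (R f h - R p h)"
      using f pH by (simp add: u_def R_scale[OF fp] R_diff)
    moreover have "cinner u h = \<i> / k f * (cinner f h - cinner p h)"
      by (simp add: u_def cinner_scaleC_left cinner_diff_left)
    ultimately have "R u h = z * cinner u h + \<i> / k f * (- \<i> * k f * cnj (k h))"
      by (simp only: ring_distribs) (simp add: algebra_simps)
    then show ?thesis using kf by simp
  qed
  have eq: "(\<lambda>h. R f h - z * embed_minus (symm_op \<Theta>) f h) = K 1 \<longleftrightarrow>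
      (\<forall>h\<in>H. R f h = z * cinner f h + cnj (k h))" if "f \<in> H" for f
  proof -
    have "(R f h - z * embed_minus (symm_op \<Theta>) f h = K 1 h) \<longleftrightarrow>
        (h \<in> H \<longrightarrow> R f h = z * cinner f h + cnj (k h))" for h
      using that by (auto simp: embed_minus_def channel_one[symmetric] R_outside channel_outside
          algebra_simps)
    then show ?thesis by (auto simp: fun_eq_iff)
  qed
  have "pm_inverse (symm_op \<Theta>) R z (K 1) = u"
    unfolding pm_inverse_def
  proof (rule the_equality)
    show "u \<in> H \<and> (\<lambda>h. R u h - z * embed_minus (symm_op \<Theta>) u h) = K 1"
      using u Ru eq by simp
    fix v assume v: "v \<in> H \<and> (\<lambda>h. R v h - z * embed_minus (symm_op \<Theta>) v h) = K 1"
    have "v - u = 0"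
    proof (rule R_shift_kernel[OF z])
      show "v - u \<in> H" using u v by (intro H_closed) auto
      show "R (v - u) h = z * cinner (v - u) h" if "h \<in> H" for h
        using v eq[of v] Ru[OF that] that u
        by (simp add: R_diff cinner_diff_left algebra_simps)
    qed
    then show "v = u" by simp
  qed
  then have "impedance_fun \<Theta> z = k u" by (simp add: impedance_fun_def)
  then show thesis using that u Ru by blast
qed

lemma impedance_cnj:
  assumes z: "Im z \<noteq> 0"
  shows "impedance_fun \<Theta> (cnj z) = cnj (impedance_fun \<Theta> z)"
proof -
  obtain u where u: "u \<in> H" "\<And>h. h \<in> H \<Longrightarrow> R u h = z * cinner u h + cnj (k h)"
    "impedance_fun \<Theta> z = k u" using impedance_vector[OF z] by blast
  obtain v where v: "v \<in> H" "\<And>h. h \<in> H \<Longrightarrow> R v h = cnj z * cinner v h + cnj (k h)"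
    "impedance_fun \<Theta> (cnj z) = k v" using impedance_vector[of "cnj z"] z by auto
  have "z * cinner u v + cnj (k v) = cnj (cnj z * cinner v u + cnj (k u))"
    using R_hermitian[OF v(1) u(1)] u(2)[OF v(1)] v(2)[OF u(1)] by simp
  then have "cnj (k v) = k u"
    using cinner_commute[of u v] by simp
  then show ?thesis using u v by (metis complex_cnj_cnj)
qed

text \<open>
  Testing \<open>(R - z) u = K 1\<close> with \<open>u\<close> itself gives \<open>Im (k u) = Im z * \<parallel>u\<parallel>\<^sup>2\<close>, since the form of
  \<open>R\<close> is real on the diagonal.
\<close>

lemma impedance_lower_half_plane:
  assumes z: "Im z < 0"
  shows "Im (impedance_fun \<Theta> z) \<le> 0"
proof -
  obtain u where u: "u \<in> H" "\<And>h. h \<in> H \<Longrightarrow> R u h = z * cinner u h + cnj (k h)"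
    "impedance_fun \<Theta> z = k u" using impedance_vector[of z] z by auto
  have "Im (R u u) = 0" using arg_cong[OF R_hermitian[OF u(1) u(1)], of Im] by simp
  then have "Im (k u) = Im z * (norm u)\<^sup>2"
    using arg_cong[OF u(2)[OF u(1)], of Im] by (simp add: cinner_self)
  then show ?thesis using u z by (simp add: mult_nonpos_nonneg)
qed

lemma one_plus_i_impedance_nonzero:
  assumes "Im z < 0"
  shows "1 + \<i> * impedance_fun \<Theta> z \<noteq> 0"
  using impedance_lower_half_plane[OF assms] by (auto simp: complex_eq_iff)

text \<open>
  The operator \<open>T\<close> is dissipative, which bounds the inverse of \<open>T - z\<close>. It is onto because
  \<open>(T - z) f = g\<close> is solved by a rank-one correction \<open>f = c u + p\<close> of \<open>p = (B - z)\<^sup>-\<^sup>1 g\<close>, where \<open>c\<close>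
  has to satisfy \<open>c (1 + \<i> V(z)) = - \<i> * k p\<close>; this is solvable since \<open>V(z) = \<i>\<close> is ruled out by the
  sign of \<open>Im (V(z))\<close>.
\<close>

lemma lower_half_plane_resolvent:
  assumes z: "Im z < 0"
  shows "z \<in> resolvent_set T"
proof -
  define V where "V = impedance_fun \<Theta> z"
  have V1: "1 + \<i> * V \<noteq> 0"
    unfolding V_def by (rule one_plus_i_impedance_nonzero[OF z])
  obtain u where u: "u \<in> H" "\<And>h. h \<in> H \<Longrightarrow> R u h = z * cinner u h + cnj (k h)"
    "V = k u" using impedance_vector[of z] z by (auto simp: V_def)
  have bound: "norm f \<le> (1 / - Im z) * norm (h - z *\<^sub>C f)" if fh: "(f, h) \<in> T" for f h
  proof (cases "f = 0")
    case True
    then show ?thesis using z by (simp add: divide_nonneg_neg divide_nonpos_neg cvec.scale_zero_right)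
  next
    case False
    have f: "f \<in> H" "S f f = cinner h f" using state_on_T[OF fh] by auto
    have "Im (S f f) = (cmod (k f))\<^sup>2"
    proof -
      have "S f f - cnj (S f f) = 2 * \<i> * complex_of_real ((cmod (k f))\<^sup>2)"
        using state_adjoint_gap[OF f(1) f(1)] by (simp only: complex_norm_square mult.assoc)
      from arg_cong[OF this, of Im] show ?thesis by (simp del: of_real_power)
    qed
    then have "- Im z * (norm f)\<^sup>2 \<le> Im (cinner (h - z *\<^sub>C f) f)"
      using f(2) by (simp add: cinner_diff_left cinner_scaleC_left cinner_self)
    also have "\<dots> \<le> norm (h - z *\<^sub>C f) * norm f"
      using cinner_Cauchy_Schwarz[of "h - z *\<^sub>C f" f] abs_Im_le_cmod[of "cinner (h - z *\<^sub>C f) f"] by linarith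
    finally have "(- Im z * norm f) * norm f \<le> norm (h - z *\<^sub>C f) * norm f"
      by (simp add: power2_eq_square)
    then have "- Im z * norm f \<le> norm (h - z *\<^sub>C f)"
      by (rule mult_right_le_imp_le) (simp add: False)
    then show ?thesis using z by (simp add: field_simps)
  qed
  have ex: "\<exists>f. (f, g + z *\<^sub>C f) \<in> T" for g
  proof -
    obtain p where p: "(p, g + z *\<^sub>C p) \<in> B"
      using self_adjoint_shift_surjective[OF self_adjoint_B] z by (metis less_irrefl)
    have pH: "p \<in> H" using p mem_B_iff by blast
    define c where "c = - \<i> * k p / (1 + \<i> * V)"
    have c: "c + \<i> * c * V = - \<i> * k p"
    proof -
      have "c * (1 + \<i> * V) = - \<i> * k p" using V1 by (simp add: c_def)
      then show ?thesis by (simp add: ring_distribs mult_ac)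
    qed
    have "(c *\<^sub>C u + p, g + z *\<^sub>C (c *\<^sub>C u + p)) \<in> T"
    proof (rule mem_T_of_state)
      show fH: "c *\<^sub>C u + p \<in> H" using u pH by (intro H_closed)
      fix h assume h: "h \<in> H"
      have "S (c *\<^sub>C u + p) h = c * R u h + R p h + \<i> * (c * V + k p) * cnj (k h)"
        using u(1,3) pH by (simp add: state_eq[OF fH h] R_linear k_linear)
      also have "\<dots> = cinner (g + z *\<^sub>C (c *\<^sub>C u + p)) h + (c + \<i> * c * V + \<i> * k p) * cnj (k h)"
        using u(2)[OF h] p h
        by (simp add: mem_B_iff cinner_add_left cinner_scaleC_left algebra_simps)
      finally show "S (c *\<^sub>C u + p) h = cinner (g + z *\<^sub>C (c *\<^sub>C u + p)) h"
        by (simp add: c)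
    qed
    then show ?thesis by blast
  qed
  have uniq: "f = f'" if "(f, g + z *\<^sub>C f) \<in> T" "(f', g + z *\<^sub>C f') \<in> T" for f f' g
  proof -
    have "cvec.subspace T" using T_props by (simp add: lin_operator_def)
    then have "(f, g + z *\<^sub>C f) - (f', g + z *\<^sub>C f') \<in> T"
      using that by (intro cvec.subspace_diff)
    then have "(f - f', g + z *\<^sub>C f - (g + z *\<^sub>C f')) \<in> T" by simp
    from bound[OF this] show ?thesis by (simp add: cvec.scale_right_diff_distrib)
  qed
  show ?thesis unfolding resolvent_set_def using ex uniq bound by blast
qed

text \<open>
  Here \<open>(S - z)\<^sup>-\<^sup>1 (K 1)\<close> is the multiple \<open>u / (1 + \<i> V(z))\<close> of the vector that defines the
  impedance function.
\<close>

lemma transfer_lower_half_plane: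
  assumes z: "Im z < 0"
  shows "transfer_fun \<Theta> z = (1 - \<i> * impedance_fun \<Theta> z) / (1 + \<i> * impedance_fun \<Theta> z)"
proof -
  define V where "V = impedance_fun \<Theta> z"
  have V1: "1 + \<i> * V \<noteq> 0"
    unfolding V_def by (rule one_plus_i_impedance_nonzero[OF z])
  obtain u where u: "u \<in> H" "\<And>h. h \<in> H \<Longrightarrow> R u h = z * cinner u h + cnj (k h)"
    "V = k u" using impedance_vector[of z] z by (auto simp: V_def)
  define f where "f = (1 / (1 + \<i> * V)) *\<^sub>C u"
  have eq: "(\<lambda>h. S f h - z * embed_minus (symm_op \<Theta>) f h) = K 1 \<longleftrightarrow>
      (\<forall>h\<in>H. S f h = z * cinner f h + cnj (k h))" if "f \<in> H" for f
  proof -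
    have "(S f h - z * embed_minus (symm_op \<Theta>) f h = K 1 h) \<longleftrightarrow>
        (h \<in> H \<longrightarrow> S f h = z * cinner f h + cnj (k h))" for h
      using that by (auto simp: embed_minus_def channel_one[symmetric] state_outside channel_outside
          algebra_simps)
    then show ?thesis by (auto simp: fun_eq_iff)
  qed
  have fH: "f \<in> H" unfolding f_def using u(1) by (rule H_closed)
  have kf: "k f = V / (1 + \<i> * V)" using u by (simp add: f_def k_scale)
  have Sf: "S f h = z * cinner f h + cnj (k h)" if h: "h \<in> H" for h
  proof -
    have "R f h = 1 / (1 + \<i> * V) * R u h"
      using R_scale[OF u(1), of "1 / (1 + \<i> * V)" h] by (simp add: f_def)
    then have "S f h = 1 / (1 + \<i> * V) * (z * cinner u h + cnj (k h)) + \<i> * (V / (1 + \<i> * V)) * cnj (k h)"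
      using state_eq[OF fH h] u(2)[OF h] kf by simp
    also have "\<dots> = z * (1 / (1 + \<i> * V) * cinner u h) + (1 + \<i> * V) / (1 + \<i> * V) * cnj (k h)"
      by (simp only: add_divide_distrib ring_distribs) (simp add: algebra_simps)
    finally show ?thesis using V1 by (simp add: f_def cinner_scaleC_left)
  qed
  have "pm_inverse (symm_op \<Theta>) S z (K 1) = f"
    unfolding pm_inverse_def
  proof (rule the_equality)
    show "f \<in> H \<and> (\<lambda>h. S f h - z * embed_minus (symm_op \<Theta>) f h) = K 1"
      using fH Sf eq by simp
    fix g assume g: "g \<in> H \<and> (\<lambda>h. S g h - z * embed_minus (symm_op \<Theta>) g h) = K 1"
    have "(g - f, z *\<^sub>C (g - f)) \<in> T"
    proof (rule mem_T_of_state)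
      show "g - f \<in> H" using fH g by (intro H_closed) auto
      show "S (g - f) h = cinner (z *\<^sub>C (g - f)) h" if "h \<in> H" for h
        using g eq[of g] Sf[OF that] that fH
        by (simp add: state_diff cinner_diff_left cinner_scaleC_left ring_distribs
            del: cvec.scale_right_diff_distrib)
    qed
    moreover have "(0, z *\<^sub>C 0) \<in> T"
      using T_props cvec.subspace_0[of T] by (simp add: lin_operator_def zero_prod_def)
    moreover have "\<exists>!f. (f, 0 + z *\<^sub>C f) \<in> T"
      using lower_half_plane_resolvent[OF z] unfolding resolvent_set_def by blast
    ultimately have "g - f = 0" by (metis add_0)
    then show "g = f" by simp
  qed
  then have "transfer_fun \<Theta> z = 1 - 2 * \<i> * (V / (1 + \<i> * V))"
    by (simp add: transfer_fun_def kf)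
  also have "\<dots> = (1 - \<i> * V) / (1 + \<i> * V)"
    using V1 by (simp add: field_simps)
  finally show ?thesis by (simp add: V_def)
qed

end

section \<open>The Herglotz representation on the disc\<close>

lemma one_minus_nonzero_in_disc:
  fixes x y :: complex
  assumes "cmod x < 1" "cmod y \<le> 1"
  shows "1 - x * y \<noteq> 0"
proof
  assume "1 - x * y = 0"
  then have "cmod x * cmod y = 1" by (simp flip: norm_mult)
  moreover have "cmod x * cmod y \<le> cmod x * 1" using assms by (intro mult_left_mono) auto
  ultimately show False using assms by simp
qed

lemma circle_minus_nonzero: "cmod \<zeta> < 1 \<Longrightarrow> cis \<theta> - \<zeta> \<noteq> 0"
  by auto

text \<open>
  Cauchy's formula gives \<open>F(\<zeta>)\<close> as the integral of \<open>F\<close> against the kernel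
  \<open>w / (w - \<zeta>)\<close>. On the circle this kernel is the conjugate of \<open>1 / (1 - cnj \<zeta> * w)\<close>, which is
  holomorphic in \<open>w\<close>, so the integral of \<open>cnj F\<close> against it only sees \<open>cnj (F 0)\<close>. Adding the two replaces
  \<open>F\<close> under the integral by its real part.
\<close>

lemma Schwarz_integral_formula:
  assumes cont: "continuous_on (cball 0 1) F" and hol: "F holomorphic_on ball 0 1"
    and \<zeta>: "cmod \<zeta> < 1"
  shows "((\<lambda>\<theta>. Re (F (cis \<theta>)) *\<^sub>R (cis \<theta> / (cis \<theta> - \<zeta>))) has_integral
      pi * (F \<zeta> + cnj (F 0))) {0..2 * pi}"
proof -
  have circ: "((\<lambda>\<theta>. f (cis \<theta>) * cis \<theta> / (cis \<theta> - w)) has_integral 2 * pi * f w) {0..2 * pi}"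
    if "continuous_on (cball 0 1) f" "f holomorphic_on ball 0 1" "cmod w < 1"
    for f :: "complex \<Rightarrow> complex" and w
  proof -
    have "((\<lambda>u. f u / (u - w)) has_contour_integral 2 * of_real pi * \<i> * f w) (circlepath 0 1)"
      using that by (intro Cauchy_integral_circlepath) auto
    then have "((\<lambda>\<theta>. f (cis \<theta>) / (cis \<theta> - w) * \<i> * cis \<theta>) has_integral 2 * of_real pi * \<i> * f w)
        {0..2 * pi}"
      unfolding circlepath_def
      by (subst (asm) has_contour_integral_part_circlepath_iff) auto
    from has_integral_mult_right[OF this, of "- \<i>"] show ?thesis
      by (simp add: mult_ac)
  qed
  have conj_kernel: "((\<lambda>\<theta>. cnj (F (cis \<theta>)) * (cis \<theta> / (cis \<theta> - \<zeta>))) has_integral 2 * pi * cnj (F 0))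
      {0..2 * pi}"
  proof -
    have nz: "1 - cnj \<zeta> * w \<noteq> 0" if "cmod w \<le> 1" for w
      using one_minus_nonzero_in_disc[of "cnj \<zeta>" w] that \<zeta> by simp
    have "((\<lambda>\<theta>. F (cis \<theta>) / (1 - cnj \<zeta> * cis \<theta>) * cis \<theta> / (cis \<theta> - 0)) has_integral
        2 * pi * (F 0 / (1 - cnj \<zeta> * 0))) {0..2 * pi}"
      by (rule circ) (use nz in \<open>auto intro!: continuous_intros holomorphic_intros cont hol\<close>)
    then have "((\<lambda>\<theta>. F (cis \<theta>) / (1 - cnj \<zeta> * cis \<theta>)) has_integral 2 * pi * F 0) {0..2 * pi}"
      by simp
    then have "(cnj \<circ> (\<lambda>\<theta>. F (cis \<theta>) / (1 - cnj \<zeta> * cis \<theta>)) has_integral cnj (2 * pi * F 0))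
        {0..2 * pi}"
      by (simp only: has_integral_cnj)
    moreover have "(cnj \<circ> (\<lambda>\<theta>. F (cis \<theta>) / (1 - cnj \<zeta> * cis \<theta>))) =
        (\<lambda>\<theta>. cnj (F (cis \<theta>)) * (cis \<theta> / (cis \<theta> - \<zeta>)))"
    proof
      fix \<theta>
      have "1 - \<zeta> * cnj (cis \<theta>) = (cis \<theta> - \<zeta>) / cis \<theta>"
        by (simp add: cis_cnj cis_inverse[symmetric] field_simps)
      then show "(cnj \<circ> (\<lambda>\<theta>. F (cis \<theta>) / (1 - cnj \<zeta> * cis \<theta>))) \<theta> =
          cnj (F (cis \<theta>)) * (cis \<theta> / (cis \<theta> - \<zeta>))"
        by simp
    qed
    ultimately show ?thesis by simp
  qed
  have "((\<lambda>\<theta>. F (cis \<theta>) * cis \<theta> / (cis \<theta> - \<zeta>)) has_integral 2 * pi * F \<zeta>) {0..2 * pi}"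
    by (rule circ[OF cont hol \<zeta>])
  from has_integral_mult_right[OF has_integral_add[OF this conj_kernel], of "1/2"]
  have "((\<lambda>\<theta>. 1/2 * (F (cis \<theta>) * cis \<theta> / (cis \<theta> - \<zeta>) + cnj (F (cis \<theta>)) * (cis \<theta> / (cis \<theta> - \<zeta>))))
      has_integral 1/2 * (2 * pi * F \<zeta> + 2 * pi * cnj (F 0))) {0..2 * pi}" .
  moreover have "1/2 * (F w * w / (w - \<zeta>) + cnj (F w) * (w / (w - \<zeta>))) = Re (F w) *\<^sub>R (w / (w - \<zeta>))" for w
  proof -
    have "1/2 * (F w * w / (w - \<zeta>) + cnj (F w) * (w / (w - \<zeta>))) = (F w + cnj (F w)) / 2 * (w / (w - \<zeta>))"
      by (simp add: ring_distribs add_divide_distrib)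
    also have "(F w + cnj (F w)) / 2 = of_real (Re (F w))" by (simp add: complex_add_cnj)
    finally show ?thesis by (simp add: scaleR_conv_of_real)
  qed
  ultimately show ?thesis by (simp add: ring_distribs)
qed

lemma bounded_Cauchy_kernel:
  assumes "cmod \<zeta> < 1"
  shows "cmod (cis \<theta> / (cis \<theta> - \<zeta>)) \<le> 1 / (1 - cmod \<zeta>)"
proof -
  have "1 - cmod \<zeta> \<le> cmod (cis \<theta> - \<zeta>)"
    using norm_triangle_ineq2[of "cis \<theta>" \<zeta>] by simp
  then show ?thesis using assms by (simp add: norm_divide frac_le)
qed

lemma isCont_Cauchy_kernel: "cmod \<zeta> < 1 \<Longrightarrow> isCont (\<lambda>\<theta>. cis \<theta> / (cis \<theta> - \<zeta>)) \<theta>"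
  using continuous_on_eq_continuous_at[of UNIV cis] circle_minus_nonzero
  by (intro continuous_intros) (auto intro: continuous_intros)

text \<open>
  The measure has the boundary values of \<open>Re F\<close> as its density over one turn of the circle, normalised
  by the mean value property. The interval \<open>{-1<..7}\<close> is an arbitrary half-open one around it; it is what
  makes the measures obtained for different \<open>F\<close> uniformly tight.
\<close>

lemma Herglotz_circle_distribution:
  assumes cont: "continuous_on (cball 0 1) F" and hol: "F holomorphic_on ball 0 1"
    and pos: "\<And>w. cmod w \<le> 1 \<Longrightarrow> Re (F w) > 0"
  obtains \<nu> :: "real measure"
  where "real_distribution \<nu>" and "measure \<nu> {-1<..7} = 1"
    and "\<And>\<zeta>. cmod \<zeta> < 1 \<Longrightarrow>
      F \<zeta> + cnj (F 0) = 2 * Re (F 0) * (\<integral>\<theta>. cis \<theta> / (cis \<theta> - \<zeta>) \<partial>\<nu>)"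
proof -
  define c where "c = 1 / (2 * pi * Re (F 0))"
  have c: "c > 0" using pos[of 0] by (simp add: c_def)
  define p where "p \<theta> = c * (indicator {0..2 * pi} \<theta> * Re (F (cis \<theta>)))" for \<theta>
  have contF: "continuous_on A (\<lambda>\<theta>. F (cis \<theta>))" for A
    by (rule continuous_on_compose2[OF cont]) (auto intro!: continuous_intros)
  have [measurable]: "(\<lambda>\<theta>. F (cis \<theta>)) \<in> borel_measurable borel"
    by (rule borel_measurable_continuous_onI[OF contF])
  have pm [measurable]: "p \<in> borel_measurable borel"
    unfolding p_def by measurable
  have p0: "p \<theta> \<ge> 0" for \<theta>
    using c pos[of "cis \<theta>"] by (simp add: p_def)
  have int: "integrable lborel (\<lambda>\<theta>. p \<theta> *\<^sub>R (cis \<theta> / (cis \<theta> - \<zeta>)))"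
    and eq: "(\<integral>\<theta>. p \<theta> *\<^sub>R (cis \<theta> / (cis \<theta> - \<zeta>)) \<partial>lborel) = c * (pi * (F \<zeta> + cnj (F 0)))"
    if "cmod \<zeta> < 1" for \<zeta>
  proof -
    let ?g = "\<lambda>\<theta>. Re (F (cis \<theta>)) *\<^sub>R (cis \<theta> / (cis \<theta> - \<zeta>))"
    have g: "set_integrable lborel {0..2 * pi} ?g"
      by (rule borel_integrable_atLeastAtMost', intro continuous_intros contF)
         (use that circle_minus_nonzero in blast)
    have *: "(\<lambda>\<theta>. p \<theta> *\<^sub>R (cis \<theta> / (cis \<theta> - \<zeta>))) = (\<lambda>\<theta>. c *\<^sub>R (indicator {0..2 * pi} \<theta> *\<^sub>R ?g \<theta>))"
      by (auto simp: p_def)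
    show "integrable lborel (\<lambda>\<theta>. p \<theta> *\<^sub>R (cis \<theta> / (cis \<theta> - \<zeta>)))"
      unfolding * using g by (intro integrable_scaleR_right) (simp add: set_integrable_def)
    have "(\<integral>\<theta>. p \<theta> *\<^sub>R (cis \<theta> / (cis \<theta> - \<zeta>)) \<partial>lborel) = c *\<^sub>R (LINT \<theta>:{0..2*pi}|lborel. ?g \<theta>)"
      unfolding * set_lebesgue_integral_def by (rule integral_scaleR_right)
    also have "(LINT \<theta>:{0..2*pi}|lborel. ?g \<theta>) = pi * (F \<zeta> + cnj (F 0))"
      unfolding set_borel_integral_eq_integral(2)[OF g]
      by (rule integral_unique[OF Schwarz_integral_formula[OF cont hol that]])
    finally show "(\<integral>\<theta>. p \<theta> *\<^sub>R (cis \<theta> / (cis \<theta> - \<zeta>)) \<partial>lborel) = c * (pi * (F \<zeta> + cnj (F 0)))"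
      by (simp add: scaleR_conv_of_real)
  qed
  have F0: "F 0 + cnj (F 0) = 2 * Re (F 0)" by (simp add: complex_add_cnj)
  have int1: "integrable lborel p" and eq1: "(\<integral>\<theta>. p \<theta> \<partial>lborel) = 1"
  proof -
    have *: "(\<lambda>\<theta>. p \<theta> *\<^sub>R (cis \<theta> / (cis \<theta> - 0))) = (\<lambda>\<theta>. complex_of_real (p \<theta>))"
      by (auto simp: scaleR_conv_of_real)
    show "integrable lborel p" using integrable_Re[OF int[of 0]] unfolding * by simp
    have "complex_of_real (\<integral>\<theta>. p \<theta> \<partial>lborel) = c * (pi * (2 * Re (F 0)))"
      using eq[of 0] unfolding * F0 by simp
    moreover have "c * (pi * (2 * Re (F 0))) = 1" using pos[of 0] by (simp add: c_def)
    ultimately show "(\<integral>\<theta>. p \<theta> \<partial>lborel) = 1" by (metis of_real_eq_iff of_real_mult)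
  qed
  define \<nu> where "\<nu> = density lborel (\<lambda>\<theta>. ennreal (p \<theta>))"
  have nn: "(\<integral>\<^sup>+ \<theta>. ennreal (p \<theta>) \<partial>lborel) = 1"
    using nn_integral_eq_integral[OF int1] p0 eq1 by simp
  have "emeasure \<nu> (space \<nu>) = 1"
    unfolding \<nu>_def by (subst emeasure_density) (use nn in simp_all)
  then interpret prob_space \<nu> by (rule prob_spaceI)
  show thesis
  proof
    show "real_distribution \<nu>"
      by unfold_locales (simp add: \<nu>_def)
    have "emeasure \<nu> {-1<..7} = (\<integral>\<^sup>+ \<theta>. ennreal (p \<theta>) * indicator {-1<..7} \<theta> \<partial>lborel)"
      unfolding \<nu>_def by (subst emeasure_density) simp_all
    also have "\<dots> = (\<integral>\<^sup>+ \<theta>. ennreal (p \<theta>) \<partial>lborel)"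
      using pi_less_4 pi_approx
      by (intro nn_integral_cong) (auto simp: p_def indicator_def)
    finally have "emeasure \<nu> {-1<..7} = 1" using nn by simp
    then show "measure \<nu> {-1<..7} = 1" by (simp add: measure_def)
    fix \<zeta> :: complex assume \<zeta>: "cmod \<zeta> < 1"
    have m: "(\<lambda>\<theta>. cis \<theta> / (cis \<theta> - \<zeta>)) \<in> borel_measurable borel"
      using isCont_Cauchy_kernel[OF \<zeta>]
      by (intro borel_measurable_continuous_onI continuous_at_imp_continuous_on) auto
    have "(\<integral>\<theta>. cis \<theta> / (cis \<theta> - \<zeta>) \<partial>\<nu>) = (\<integral>\<theta>. p \<theta> *\<^sub>R (cis \<theta> / (cis \<theta> - \<zeta>)) \<partial>lborel)"
      unfolding \<nu>_def using m p0 by (subst integral_density) auto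
    also have "\<dots> = c * (pi * (F \<zeta> + cnj (F 0)))" by (rule eq[OF \<zeta>])
    finally have "2 * Re (F 0) * (\<integral>\<theta>. cis \<theta> / (cis \<theta> - \<zeta>) \<partial>\<nu>) =
        of_real (2 * Re (F 0) * c * pi) * (F \<zeta> + cnj (F 0))" by simp
    also have "2 * Re (F 0) * c * pi = 1" using pos[of 0] by (simp add: c_def)
    finally show "F \<zeta> + cnj (F 0) = 2 * Re (F 0) * (\<integral>\<theta>. cis \<theta> / (cis \<theta> - \<zeta>) \<partial>\<nu>)" by simp
  qed
qed

text \<open>
  The functions \<open>F(r \<zeta>)\<close> with \<open>r < 1\<close> are continuous up to the circle. Their boundary
  distributions are carried by one bounded interval of angles, so by Helly's theorem some sequence
  \<open>r \<rightarrow> 1\<close> converges weakly, and for fixed \<open>\<zeta>\<close> the kernel is bounded and continuous in the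
  angle. The limit is kept as a distribution of angles in \<open>\<real>\<close>: all integrands are periodic, so
  nothing depends on the choice of a period.
\<close>

theorem Herglotz_representation_disc:
  assumes hol: "F holomorphic_on ball 0 1"
    and pos: "\<And>w. cmod w < 1 \<Longrightarrow> Re (F w) > 0"
  obtains \<nu> :: "real measure"
  where "real_distribution \<nu>"
    and "\<And>\<zeta>. cmod \<zeta> < 1 \<Longrightarrow>
      F \<zeta> + cnj (F 0) = 2 * Re (F 0) * (\<integral>\<theta>. cis \<theta> / (cis \<theta> - \<zeta>) \<partial>\<nu>)"
proof -
  define r where "r n = 1 - 1 / real (Suc (Suc n))" for n
  have r: "0 \<le> r n" "r n < 1" for n by (simp_all add: r_def)
  have r_lim: "r \<longlonglongrightarrow> 1"
  proof -
    have "(\<lambda>n. 1 - inverse (real (Suc (Suc n)))) \<longlonglongrightarrow> 1 - 0"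
      by (intro tendsto_intros LIMSEQ_Suc[OF LIMSEQ_inverse_real_of_nat])
    then show ?thesis by (simp add: r_def[abs_def] inverse_eq_divide)
  qed
  have "\<exists>\<nu>. real_distribution \<nu> \<and> measure \<nu> {-1<..7} = 1 \<and> (\<forall>\<zeta>::complex. cmod \<zeta> < 1 \<longrightarrow>
      F (r n * \<zeta>) + cnj (F 0) = 2 * Re (F 0) * (\<integral>\<theta>. cis \<theta> / (cis \<theta> - \<zeta>) \<partial>\<nu>))" for n
  proof -
    have in_disc: "cmod (r n * w) < 1" if "cmod w \<le> 1" for w :: complex
    proof -
      have "r n * cmod w \<le> r n * 1" using r[of n] that by (intro mult_left_mono) auto
      then show ?thesis using r[of n] by (simp add: norm_mult)
    qed
    have c: "continuous_on (cball 0 1) (\<lambda>w::complex. F (r n * w))"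
      by (rule continuous_on_compose2[OF holomorphic_on_imp_continuous_on[OF hol]])
         (use in_disc in \<open>auto intro!: continuous_intros\<close>)
    have h: "(\<lambda>w::complex. F (r n * w)) holomorphic_on ball 0 1"
      by (rule holomorphic_on_compose_gen[OF _ hol, unfolded o_def])
         (use in_disc in \<open>auto intro!: holomorphic_intros\<close>)
    have p: "Re (F (r n * w)) > 0" if "cmod w \<le> 1" for w :: complex
      using pos in_disc[OF that] by blast
    show ?thesis
      by (rule Herglotz_circle_distribution[OF c h p]) auto
  qed
  then obtain \<nu> where \<nu>: "\<And>n. real_distribution (\<nu> n)" and mass: "\<And>n. measure (\<nu> n) {-1<..7} = 1"
    and rep: "\<And>n (\<zeta>::complex). cmod \<zeta> < 1 \<Longrightarrow>
      F (r n * \<zeta>) + cnj (F 0) = 2 * Re (F 0) * (\<integral>\<theta>. cis \<theta> / (cis \<theta> - \<zeta>) \<partial>\<nu> n)"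
    by metis
  have "tight \<nu>"
    unfolding tight_def
  proof (intro conjI allI impI \<nu>)
    fix \<epsilon> :: real assume "\<epsilon> > 0"
    then show "\<exists>a b. a < b \<and> (\<forall>n. 1 - \<epsilon> < measure (\<nu> n) {a<..b})"
      using mass by (intro exI[of _ "- 1"] exI[of _ 7]) simp
  qed
  then obtain s M where s: "strict_mono (s :: nat \<Rightarrow> nat)" and M: "real_distribution M"
    and conv: "weak_conv_m (\<nu> \<circ> id \<circ> s) M"
    using tight_imp_convergent_subsubsequence[OF _ strict_mono_id] by blast
  show thesis
  proof
    show "real_distribution M" by (rule M)
    fix \<zeta> :: complex assume \<zeta>: "cmod \<zeta> < 1"
    have "(\<lambda>n. \<integral>\<theta>. cis \<theta> / (cis \<theta> - \<zeta>) \<partial>(\<nu> \<circ> id \<circ> s) n) \<longlonglongrightarrow> (\<integral>\<theta>. cis \<theta> / (cis \<theta> - \<zeta>) \<partial>M)"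
      using \<nu> by (intro weak_conv_imp_integral_bdd_continuous_conv[OF _ M conv _ bounded_Cauchy_kernel[OF \<zeta>]]
          isCont_Cauchy_kernel[OF \<zeta>]) simp
    then have "(\<lambda>n. 2 * Re (F 0) * (\<integral>\<theta>. cis \<theta> / (cis \<theta> - \<zeta>) \<partial>\<nu> (s n))) \<longlonglongrightarrow>
        2 * Re (F 0) * (\<integral>\<theta>. cis \<theta> / (cis \<theta> - \<zeta>) \<partial>M)"
      by (intro tendsto_intros) simp
    then have "(\<lambda>n. F (r (s n) * \<zeta>) + cnj (F 0)) \<longlonglongrightarrow> 2 * Re (F 0) * (\<integral>\<theta>. cis \<theta> / (cis \<theta> - \<zeta>) \<partial>M)"
      by (simp add: rep[OF \<zeta>])
    moreover have "(\<lambda>n. F (r (s n) * \<zeta>) + cnj (F 0)) \<longlonglongrightarrow> F \<zeta> + cnj (F 0)"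
    proof (intro tendsto_intros)
      have "isCont F \<zeta>"
        using holomorphic_on_imp_continuous_on[OF hol] \<zeta>
        by (simp add: continuous_on_eq_continuous_at)
      moreover have "(\<lambda>n. complex_of_real (r (s n)) * \<zeta>) \<longlonglongrightarrow> of_real 1 * \<zeta>"
        using LIMSEQ_subseq_LIMSEQ[OF r_lim s] by (intro tendsto_intros) (simp add: o_def)
      ultimately show "(\<lambda>n. F (r (s n) * \<zeta>)) \<longlonglongrightarrow> F \<zeta>"
        using isCont_tendsto_compose[of \<zeta> F] by simp
    qed
    ultimately show "F \<zeta> + cnj (F 0) = 2 * Re (F 0) * (\<integral>\<theta>. cis \<theta> / (cis \<theta> - \<zeta>) \<partial>M)"
      using LIMSEQ_unique by blast
  qed
qed

section \<open>The Nevanlinna representation on the half-plane\<close>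

definition Nevanlinna_kernel :: "complex \<Rightarrow> real \<Rightarrow> complex" where
  "Nevanlinna_kernel z x = 1 / (complex_of_real x - z) - complex_of_real (x / (1 + x\<^sup>2))"

lemma one_plus_square_pos: "1 + x\<^sup>2 > (0::real)"
  by (simp add: add_pos_nonneg)

lemma of_real_minus_nonreal: "Im z \<noteq> 0 \<Longrightarrow> complex_of_real x - z \<noteq> 0"
  by (auto simp: complex_eq_iff)

lemma Nevanlinna_kernel_eq:
  assumes "Im z \<noteq> 0"
  shows "Nevanlinna_kernel z x = (1 + x * z) / (x - z) / complex_of_real (1 + x\<^sup>2)"
proof -
  have "complex_of_real (1 + x\<^sup>2) \<noteq> 0"
    using one_plus_square_pos[of x] by (metis of_real_eq_0_iff less_irrefl)
  moreover have "Nevanlinna_kernel z x * ((x - z) * complex_of_real (1 + x\<^sup>2)) =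
      1 + x * z"
  proof -
    have "Nevanlinna_kernel z x * ((x - z) * complex_of_real (1 + x\<^sup>2)) =
        complex_of_real (1 + x\<^sup>2) - x * (x - z)"
    proof -
      have "(1 / u - complex_of_real (x / (1 + x\<^sup>2))) * (u * complex_of_real (1 + x\<^sup>2)) =
          complex_of_real (1 + x\<^sup>2) - x * u" if "u \<noteq> 0" for u :: complex
        using that calculation by (simp add: left_diff_distrib)
      then show ?thesis
        using of_real_minus_nonreal[OF assms, of x] by (simp only: Nevanlinna_kernel_def)
    qed
    then show ?thesis by (simp add: right_diff_distrib power2_eq_square)
  qed
  ultimately have "Nevanlinna_kernel z x = (1 + x * z) / ((x - z) * complex_of_real (1 + x\<^sup>2))"
    using of_real_minus_nonreal[OF assms, of x] by (simp only: eq_divide_eq) simp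
  then show ?thesis by (simp only: divide_divide_eq_left)
qed

lemma measurable_Nevanlinna_kernel [measurable]: "Nevanlinna_kernel z \<in> borel_measurable borel"
  unfolding Nevanlinna_kernel_def by measurable

lemma Nevanlinna_kernel_bound:
  assumes z: "Im z > 0"
  shows "cmod (Nevanlinna_kernel z x) \<le> (cmod (1 + z\<^sup>2) / Im z + cmod z) * (1 / (1 + x\<^sup>2))"
proof -
  have nz: "complex_of_real x - z \<noteq> 0" using of_real_minus_nonreal z by simp
  have "(1 + x * z) / (x - z) = (1 + z\<^sup>2) / (x - z) + z"
    using nz by (simp add: field_simps power2_eq_square)
  then have "cmod ((1 + x * z) / (x - z)) \<le> cmod (1 + z\<^sup>2) / cmod (x - z) + cmod z"
    by (metis norm_divide norm_triangle_ineq)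
  also have "Im z \<le> cmod (x - z)"
    using abs_Im_le_cmod[of "x - z"] z by simp
  then have "cmod (1 + z\<^sup>2) / cmod (x - z) \<le> cmod (1 + z\<^sup>2) / Im z"
    using z by (intro divide_left_mono mult_pos_pos) auto
  finally have "cmod ((1 + x * z) / (x - z)) \<le> cmod (1 + z\<^sup>2) / Im z + cmod z" by simp
  moreover have "cmod (complex_of_real (1 + x\<^sup>2)) = 1 + x\<^sup>2"
    using one_plus_square_pos[of x] unfolding norm_of_real by simp
  ultimately have "cmod ((1 + x * z) / (x - z)) / cmod (complex_of_real (1 + x\<^sup>2)) \<le>
      (cmod (1 + z\<^sup>2) / Im z + cmod z) / (1 + x\<^sup>2)"
    using one_plus_square_pos[of x] by (simp only: divide_right_mono less_imp_le)
  then show ?thesis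
    using z by (simp only: Nevanlinna_kernel_eq[OF less_imp_neq[OF z, symmetric]] norm_divide times_divide_eq_right mult_1_right)
qed

text \<open>
  The boundary value at \<open>cis \<theta>\<close> of the Cayley map from the disc to the upper half-plane; the point
  \<open>cis \<theta> = 1\<close> corresponds to infinity.
\<close>

definition line_point :: "real \<Rightarrow> real" where
  "line_point \<theta> = Re (\<i> * (1 + cis \<theta>) / (1 - cis \<theta>))"

lemma measurable_line_point [measurable]: "line_point \<in> borel_measurable borel"
proof -
  have [measurable]: "cis \<in> borel_measurable borel"
    by (intro borel_measurable_continuous_onI continuous_intros)
  show ?thesis unfolding line_point_def by measurable
qed

lemma line_point_Cayley:
  assumes "cis \<theta> \<noteq> 1"
  shows "cis \<theta> * (line_point \<theta> + \<i>) = line_point \<theta> - \<i>"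
proof -
  define w where "w = cis \<theta>"
  define m where "m = \<i> * (1 + w) / (1 - w)"
  have w: "w \<noteq> 0" "1 - w \<noteq> 0" "cnj w = 1 / w"
    using assms by (auto simp: w_def cis_cnj cis_inverse[symmetric] inverse_eq_divide)
  have "cnj m = - \<i> * (1 + 1 / w) / (1 - 1 / w)"
    by (simp add: m_def w)
  also have "\<dots> = - \<i> * ((w + 1) / w) / ((w - 1) / w)"
    using w by (simp add: add_divide_distrib diff_divide_distrib)
  also have "\<dots> = m" using w by (simp add: m_def field_simps)
  finally have "of_real (line_point \<theta>) = m"
    by (simp add: line_point_def flip: w_def m_def) (simp add: complex_eq_iff)
  moreover have "w * (m + \<i>) = m - \<i>"
    using w by (simp add: m_def field_simps)
  ultimately show ?thesis by (simp add: w_def)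
qed

lemma Cayley_kernel:
  fixes z \<zeta> :: complex
  assumes "cis \<theta> \<noteq> 1" and z: "Im z > 0" and \<zeta>: "\<zeta> = (z - \<i>) / (z + \<i>)"
  shows "\<i> * ((cis \<theta> + \<zeta>) / (cis \<theta> - \<zeta>)) = (1 + line_point \<theta> * z) / (line_point \<theta> - z)"
proof -
  let ?l = "complex_of_real (line_point \<theta>)"
  have n: "?l + \<i> \<noteq> 0" "z + \<i> \<noteq> 0" "?l - z \<noteq> 0"
    using z by (auto simp: complex_eq_iff)
  have w: "cis \<theta> = (?l - \<i>) / (?l + \<i>)"
    using line_point_Cayley[OF assms(1)] n by (simp add: eq_divide_eq)
  have "cis \<theta> + \<zeta> = 2 * (1 + ?l * z) / ((?l + \<i>) * (z + \<i>))"
    unfolding w \<zeta> using n by (simp add: add_frac_eq) (simp add: algebra_simps)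
  moreover have "cis \<theta> - \<zeta> = 2 * \<i> * (?l - z) / ((?l + \<i>) * (z + \<i>))"
    unfolding w \<zeta> using n by (simp add: diff_frac_eq) (simp add: algebra_simps)
  ultimately have "\<i> * ((cis \<theta> + \<zeta>) / (cis \<theta> - \<zeta>)) = \<i> * (2 * (1 + ?l * z) / (2 * \<i> * (?l - z)))"
    using n by simp
  also have "\<dots> = (1 + ?l * z) / (?l - z)"
    using n by (simp only: mult.assoc mult_divide_mult_cancel_left_if times_divide_eq_right) simp
  finally show ?thesis .
qed

text \<open>
  The Cayley map \<open>\<zeta> \<mapsto> \<i> (1 + \<zeta>) / (1 - \<zeta>)\<close> carries the disc representation of
  \<open>- \<i> V\<close> over to the half-plane. The mass at \<open>cis \<theta> = 1\<close>, that is at infinity, becomes the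
  linear term \<open>L z\<close>; the remaining mass is pushed to the line and acquires the density
  \<open>1 + x\<^sup>2\<close>. Thus the total mass \<open>Im (V \<i>)\<close> is shared between \<open>L\<close> and the weighted integral of
  \<open>\<mu>\<close>.
\<close>

theorem Nevanlinna_representation:
  assumes V: "herglotz_nevanlinna V"
  obtains L :: real and \<mu> :: "real measure"
  where "0 \<le> L" "L \<le> Im (V \<i>)" "sets \<mu> = sets borel"
    and "(\<integral>\<^sup>+ x. ennreal (1 / (1 + x\<^sup>2)) \<partial>\<mu>) = ennreal (Im (V \<i>) - L)"
    and "\<And>z::complex. Im z > 0 \<Longrightarrow> V z = Re (V \<i>) + L * z + (\<integral>x. Nevanlinna_kernel z x \<partial>\<mu>)"
proof -
  define a where "a = Im (V \<i>)"
  have a: "a > 0" using V by (simp add: herglotz_nevanlinna_def a_def)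
  define F where "F \<zeta> = - \<i> * V (\<i> * ((1 + \<zeta>) / (1 - \<zeta>)))" for \<zeta>
  have up: "Im (\<i> * ((1 + \<zeta>) / (1 - \<zeta>))) > 0" if "cmod \<zeta> < 1" for \<zeta>
  proof -
    have "Re ((1 + \<zeta>) * cnj (1 - \<zeta>)) = 1 - (cmod \<zeta>)\<^sup>2"
      unfolding cmod_power2 by (simp add: algebra_simps power2_eq_square)
    moreover have "(cmod \<zeta>)\<^sup>2 < 1" using that by (simp add: power_less_one_iff)
    moreover have "1 - \<zeta> \<noteq> 0" using that by auto
    ultimately show ?thesis
      by (simp add: complex_div_cnj[of "1 + \<zeta>"] flip: of_real_power)
  qed
  have hol: "F holomorphic_on ball 0 1"
  proof -
    have "(\<lambda>\<zeta>. V (\<i> * ((1 + \<zeta>) / (1 - \<zeta>)))) holomorphic_on ball 0 1"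
      by (rule holomorphic_on_compose_gen[of _ _ V "{z. Im z > 0}", unfolded o_def])
         (use V up in \<open>auto simp: herglotz_nevanlinna_def intro!: holomorphic_intros\<close>)
    then show ?thesis unfolding F_def by (intro holomorphic_intros)
  qed
  have pos: "Re (F \<zeta>) > 0" if "cmod \<zeta> < 1" for \<zeta>
    using V up[OF that] by (simp add: F_def herglotz_nevanlinna_def)
  obtain \<nu> :: "real measure" where \<nu>: "real_distribution \<nu>"
    and rep: "\<And>\<zeta>. cmod \<zeta> < 1 \<Longrightarrow>
      F \<zeta> + cnj (F 0) = 2 * Re (F 0) * (\<integral>\<theta>. cis \<theta> / (cis \<theta> - \<zeta>) \<partial>\<nu>)"
    using Herglotz_representation_disc[OF hol pos] by blast
  interpret real_distribution \<nu> by (rule \<nu>)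
  define E where "E = {\<theta>. cis \<theta> = 1}"
  have [measurable]: "cis \<in> borel_measurable borel"
    by (intro borel_measurable_continuous_onI continuous_intros)
  have E [measurable]: "E \<in> sets borel" unfolding E_def by measurable
  define L where "L = a * measure \<nu> E"
  define p where "p \<theta> = a * (1 + (line_point \<theta>)\<^sup>2) * indicator (- E) \<theta>" for \<theta>
  have p0: "p \<theta> \<ge> 0" for \<theta> using a by (simp add: p_def)
  have [measurable]: "p \<in> borel_measurable borel" unfolding p_def by measurable
  define \<mu> where "\<mu> = distr (density \<nu> (\<lambda>\<theta>. ennreal (p \<theta>))) borel line_point"
  have [measurable]: "line_point \<in> borel_measurable \<nu>" "p \<in> borel_measurable \<nu>"
    using measurable_line_point by measurable
  show thesis
  proof
    show "0 \<le> L" using a by (simp add: L_def)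
    show "L \<le> Im (V \<i>)" using a mult_left_mono[OF prob_le_1[of E], of a] by (simp add: L_def a_def)
    show "sets \<mu> = sets borel" by (simp add: \<mu>_def)
    have "(\<integral>\<^sup>+ x. ennreal (1 / (1 + x\<^sup>2)) \<partial>\<mu>) =
        (\<integral>\<^sup>+ \<theta>. ennreal (p \<theta>) * ennreal (1 / (1 + (line_point \<theta>)\<^sup>2)) \<partial>\<nu>)"
      unfolding \<mu>_def by (subst nn_integral_distr, simp, simp, subst nn_integral_density) simp_all
    also have "\<dots> = (\<integral>\<^sup>+ \<theta>. ennreal a * indicator (- E) \<theta> \<partial>\<nu>)"
    proof (intro nn_integral_cong)
      fix \<theta>
      have "p \<theta> * (1 / (1 + (line_point \<theta>)\<^sup>2)) = a * indicator (- E) \<theta>"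
        using one_plus_square_pos[of "line_point \<theta>"] by (simp add: p_def)
      then show "ennreal (p \<theta>) * ennreal (1 / (1 + (line_point \<theta>)\<^sup>2)) = ennreal a * indicator (- E) \<theta>"
        using a by (auto simp: p0 indicator_def simp flip: ennreal_mult split: if_splits)
    qed
    also have "\<dots> = ennreal a * emeasure \<nu> (- E)"
      by (subst nn_integral_cmult_indicator) simp_all
    also have "emeasure \<nu> (- E) = ennreal (1 - measure \<nu> E)"
      using prob_compl[of E] by (simp add: emeasure_eq_measure Compl_eq_Diff_UNIV)
    also have "ennreal a * \<dots> = ennreal (Im (V \<i>) - L)"
      using a by (simp add: L_def a_def algebra_simps flip: ennreal_mult)
    finally show "(\<integral>\<^sup>+ x. ennreal (1 / (1 + x\<^sup>2)) \<partial>\<mu>) = ennreal (Im (V \<i>) - L)" .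
    fix z assume z: "Im z > 0"
    define \<zeta> where "\<zeta> = (z - \<i>) / (z + \<i>)"
    have zi: "z + \<i> \<noteq> 0" using z by (auto simp: complex_eq_iff)
    have "(cmod (z - \<i>))\<^sup>2 < (cmod (z + \<i>))\<^sup>2"
      using z unfolding cmod_power2 by (simp add: power2_eq_square algebra_simps)
    then have "cmod (z - \<i>) < cmod (z + \<i>)" by (rule power2_less_imp_less) simp
    then have \<zeta>: "cmod \<zeta> < 1" using zi by (simp add: \<zeta>_def norm_divide)
    have "1 + \<zeta> = 2 * z / (z + \<i>)" "1 - \<zeta> = 2 * \<i> / (z + \<i>)"
      using zi by (simp_all add: \<zeta>_def field_simps)
    then have F\<zeta>: "F \<zeta> = - \<i> * V z" using zi by (simp add: F_def)
    have F0: "F 0 = - \<i> * V \<i>" "Re (F 0) = a" by (simp_all add: F_def a_def)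
    \<comment> \<open>The kernel \<open>g\<close> equals \<open>z\<close> on \<open>E\<close>, and off \<open>E\<close> it is the Nevanlinna kernel at the
      corresponding real point times \<open>1 + x\<^sup>2\<close>.\<close>
    define g where "g \<theta> = \<i> * ((cis \<theta> + \<zeta>) / (cis \<theta> - \<zeta>))" for \<theta>
    have g_eq: "g \<theta> = 2 * \<i> * (cis \<theta> / (cis \<theta> - \<zeta>)) - \<i>" for \<theta>
      using circle_minus_nonzero[OF \<zeta>, of \<theta>] by (simp add: g_def field_simps)
    have [measurable]: "(\<lambda>\<theta>. cis \<theta> / (cis \<theta> - \<zeta>)) \<in> borel_measurable \<nu>" by measurable
    have K: "integrable \<nu> (\<lambda>\<theta>. cis \<theta> / (cis \<theta> - \<zeta>))"
      by (rule integrable_const_bound[where B = "1 / (1 - cmod \<zeta>)"])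
         (simp_all add: bounded_Cauchy_kernel[OF \<zeta>] del: norm_divide)
    then have g_int: "integrable \<nu> g" unfolding g_eq[abs_def]
      by (intro Bochner_Integration.integrable_diff integrable_mult_right) simp_all
    have "- \<i> * V z + cnj (- \<i> * V \<i>) = 2 * a * (\<integral>\<theta>. cis \<theta> / (cis \<theta> - \<zeta>) \<partial>\<nu>)"
      using rep[OF \<zeta>] unfolding F\<zeta> F0(2) unfolding F0(1) .
    then have "\<i> * (- \<i> * V z + cnj (- \<i> * V \<i>)) = \<i> * (2 * a * (\<integral>\<theta>. cis \<theta> / (cis \<theta> - \<zeta>) \<partial>\<nu>))"
      by simp
    then have "V z = cnj (V \<i>) + 2 * \<i> * a * (\<integral>\<theta>. cis \<theta> / (cis \<theta> - \<zeta>) \<partial>\<nu>)"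
      by (simp add: algebra_simps)
    also have "cnj (V \<i>) = Re (V \<i>) - \<i> * a" by (simp add: complex_eq_iff a_def)
    also have "Re (V \<i>) - \<i> * a + 2 * \<i> * a * (\<integral>\<theta>. cis \<theta> / (cis \<theta> - \<zeta>) \<partial>\<nu>) =
        Re (V \<i>) + a * (\<integral>\<theta>. g \<theta> \<partial>\<nu>)"
    proof -
      have "(\<integral>\<theta>. g \<theta> \<partial>\<nu>) = 2 * \<i> * (\<integral>\<theta>. cis \<theta> / (cis \<theta> - \<zeta>) \<partial>\<nu>) - \<i>"
        unfolding g_eq using K
        by (subst Bochner_Integration.integral_diff, intro integrable_mult_right, assumption, simp,
            subst integral_mult_right_zero) (use prob_space in simp)
      then show ?thesis by (simp only:) (simp add: algebra_simps)
    qed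
    also have "(\<integral>\<theta>. g \<theta> \<partial>\<nu>) = (\<integral>\<theta>. indicator E \<theta> *\<^sub>R z + indicator (- E) \<theta> *\<^sub>R g \<theta> \<partial>\<nu>)"
    proof (intro Bochner_Integration.integral_cong refl)
      fix \<theta>
      have "g \<theta> = z" if "cis \<theta> = 1"
        using that \<open>1 + \<zeta> = _\<close> \<open>1 - \<zeta> = _\<close> zi by (simp add: g_def)
      then show "g \<theta> = indicator E \<theta> *\<^sub>R z + indicator (- E) \<theta> *\<^sub>R g \<theta>"
        by (auto simp: E_def indicator_def)
    qed
    also have "\<dots> = measure \<nu> E *\<^sub>R z + (\<integral>\<theta>. indicator (- E) \<theta> *\<^sub>R g \<theta> \<partial>\<nu>)"
    proof -
      have "integrable \<nu> (\<lambda>\<theta>. indicator (- E) \<theta> *\<^sub>R g \<theta>)"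
        by (rule integrable_mult_indicator) (simp_all add: g_int)
      moreover have "integrable \<nu> (\<lambda>\<theta>. indicator E \<theta> *\<^sub>R z)"
        by (rule integrable_mult_indicator) simp_all
      moreover have "(\<integral>\<theta>. indicator E \<theta> *\<^sub>R z \<partial>\<nu>) = measure \<nu> E *\<^sub>R z"
        by (subst integral_scaleR_left) (simp_all add: emeasure_eq_measure)
      ultimately show ?thesis by (simp only: Bochner_Integration.integral_add)
    qed
    finally have V_eq: "V z = Re (V \<i>) + a * (measure \<nu> E *\<^sub>R z + (\<integral>\<theta>. indicator (- E) \<theta> *\<^sub>R g \<theta> \<partial>\<nu>))" .
    have "(\<integral>x. Nevanlinna_kernel z x \<partial>\<mu>) = a * (\<integral>\<theta>. indicator (- E) \<theta> *\<^sub>R g \<theta> \<partial>\<nu>)"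
    proof -
      have "(\<integral>x. Nevanlinna_kernel z x \<partial>\<mu>) = (\<integral>\<theta>. p \<theta> *\<^sub>R Nevanlinna_kernel z (line_point \<theta>) \<partial>\<nu>)"
        unfolding \<mu>_def
        by (subst integral_distr, simp, simp, subst integral_density) (simp_all add: p0)
      also have "\<dots> = (\<integral>\<theta>. a * (indicator (- E) \<theta> *\<^sub>R g \<theta>) \<partial>\<nu>)"
      proof (intro Bochner_Integration.integral_cong refl)
        fix \<theta>
        show "p \<theta> *\<^sub>R Nevanlinna_kernel z (line_point \<theta>) = a * (indicator (- E) \<theta> *\<^sub>R g \<theta>)"
        proof (cases "\<theta> \<in> E")
          case False
          then have "g \<theta> = (1 + line_point \<theta> * z) / (line_point \<theta> - z)"
            unfolding g_def using Cayley_kernel[OF _ z \<zeta>_def] by (simp add: E_def)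
          moreover have "complex_of_real (1 + (line_point \<theta>)\<^sup>2) \<noteq> 0"
            using one_plus_square_pos[of "line_point \<theta>"] by (metis of_real_eq_0_iff less_irrefl)
          moreover have "p \<theta> *\<^sub>R w = a * (of_real (1 + (line_point \<theta>)\<^sup>2) * w)" for w :: complex
            using False by (simp add: p_def scaleR_conv_of_real)
          ultimately show ?thesis
            using False z by (simp add: Nevanlinna_kernel_eq del: of_real_add of_real_power)
        qed (simp add: p_def)
      qed
      also have "\<dots> = a * (\<integral>\<theta>. indicator (- E) \<theta> *\<^sub>R g \<theta> \<partial>\<nu>)"
        by (rule integral_mult_right_zero)
      finally show ?thesis .
    qed
    then show "V z = Re (V \<i>) + L * z + (\<integral>x. Nevanlinna_kernel z x \<partial>\<mu>)"
      unfolding V_eq by (simp add: L_def ring_distribs scaleR_conv_of_real)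
  qed
qed

section \<open>Growth along the imaginary axis\<close>

locale Nevanlinna_measure =
  fixes \<mu> :: "real measure" and a :: real
  assumes sets_eq [simp, measurable_cong]: "sets \<mu> = sets borel"
    and weight: "(\<integral>\<^sup>+ x. ennreal (1 / (1 + x\<^sup>2)) \<partial>\<mu>) = ennreal a"
begin

abbreviation G :: "complex \<Rightarrow> complex" where
  "G z \<equiv> (\<integral>x. Nevanlinna_kernel z x \<partial>\<mu>)"

lemma space_eq [simp]: "space \<mu> = UNIV"
  using sets_eq_imp_space_eq[OF sets_eq] by simp

lemma weight_integrable: "integrable \<mu> (\<lambda>x. 1 / (1 + x\<^sup>2))"
  by (rule integrableI_nonneg) (use weight one_plus_square_pos in \<open>auto intro: less_imp_le\<close>)

lemma measurable_kernel [measurable]: "Nevanlinna_kernel z \<in> borel_measurable \<mu>"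
  using measurable_Nevanlinna_kernel[of z] measurable_cong_sets[OF sets_eq refl] by blast

lemma kernel_integrable: "Im z > 0 \<Longrightarrow> integrable \<mu> (Nevanlinna_kernel z)"
  using one_plus_square_pos
  by (intro Bochner_Integration.integrable_bound[OF integrable_mult_right[OF weight_integrable,
          of "cmod (1 + z\<^sup>2) / Im z + cmod z"]])
     (auto intro!: order_trans[OF Nevanlinna_kernel_bound] order_trans[OF _ abs_ge_self])

lemma Im_kernel_imaginary:
  assumes "y > 0"
  shows "Im (Nevanlinna_kernel (\<i> * complex_of_real y) x) = y / (x\<^sup>2 + y\<^sup>2)"
proof -
  have "Im (1 / (complex_of_real x - \<i> * complex_of_real y)) = y / (x\<^sup>2 + y\<^sup>2)"
    by (simp add: Im_divide cmod_power2)
  then show ?thesis by (simp add: Nevanlinna_kernel_def del: of_real_divide)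
qed

lemma Im_G_imaginary: "y > 0 \<Longrightarrow> Im (G (\<i> * complex_of_real y)) = (\<integral>x. y / (x\<^sup>2 + y\<^sup>2) \<partial>\<mu>)"
  using integral_Im[OF kernel_integrable, of "\<i> * complex_of_real y"]
  by (simp add: Im_kernel_imaginary)

lemma Im_G_nonneg: "y > 0 \<Longrightarrow> Im (G (\<i> * complex_of_real y)) \<ge> 0"
  by (simp add: Im_G_imaginary)

lemma G_at_i:
  assumes "a \<ge> 0"
  shows "G \<i> = \<i> * a"
proof -
  have "(\<integral>x. 1 / (1 + x\<^sup>2) \<partial>\<mu>) = a"
    using weight_integrable assms weight one_plus_square_pos
    by (subst integral_eq_nn_integral) (auto intro: less_imp_le)
  moreover have "Nevanlinna_kernel \<i> x = \<i> * complex_of_real (1 / (1 + x\<^sup>2))" for x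
  proof -
    have "complex_of_real x - \<i> \<noteq> 0" by (simp add: complex_eq_iff)
    then have "(1 + x * \<i>) / (x - \<i>) = \<i>" by (simp add: field_simps)
    then show ?thesis using Nevanlinna_kernel_eq[of \<i> x] by simp
  qed
  ultimately show ?thesis by (simp del: of_real_divide)
qed

text \<open>
  \<open>y * Im (G (\<i> y)) = \<integral> y\<^sup>2 / (x\<^sup>2 + y\<^sup>2) d\<mu>\<close>, and the integrand increases to \<open>1\<close>.
\<close>

lemma imaginary_part_growth:
  assumes "emeasure \<mu> UNIV = \<infinity>"
  shows "eventually (\<lambda>n. C < real (Suc n) * Im (G (\<i> * complex_of_real (real (Suc n))))) sequentially"
proof -
  define q where "q n x = (real (Suc n))\<^sup>2 / (x\<^sup>2 + (real (Suc n))\<^sup>2)" for n x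
  have q: "q n x = 1 - x\<^sup>2 / (x\<^sup>2 + (real (Suc n))\<^sup>2)" for n x
  proof -
    have "x\<^sup>2 + (real (Suc n))\<^sup>2 > 0" by (simp add: add_nonneg_pos)
    then show ?thesis by (simp add: q_def field_simps)
  qed
  have q_lim: "(\<lambda>n. q n x) \<longlonglongrightarrow> 1" for x
  proof -
    have "(\<lambda>n. 1 / (1 + x\<^sup>2 * (inverse (real (Suc n)))\<^sup>2)) \<longlonglongrightarrow> 1 / (1 + x\<^sup>2 * 0\<^sup>2)"
      by (intro tendsto_intros LIMSEQ_inverse_real_of_nat) simp
    moreover have "1 / (1 + x\<^sup>2 * (inverse (real (Suc n)))\<^sup>2) = q n x" for n
    proof -
      have "1 + x\<^sup>2 * (inverse (real (Suc n)))\<^sup>2 = (x\<^sup>2 + (real (Suc n))\<^sup>2) / (real (Suc n))\<^sup>2"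
        by (simp add: field_simps power2_eq_square del: of_nat_Suc)
      then show ?thesis by (simp add: q_def del: of_nat_Suc)
    qed
    ultimately show ?thesis by simp
  qed
  have q_mono: "q m x \<le> q n x" if "m \<le> n" for m n x
  proof -
    have "(real (Suc m))\<^sup>2 \<le> (real (Suc n))\<^sup>2" using that by (intro power_mono) auto
    then have "x\<^sup>2 / (x\<^sup>2 + (real (Suc n))\<^sup>2) \<le> x\<^sup>2 / (x\<^sup>2 + (real (Suc m))\<^sup>2)"
      by (intro divide_left_mono mult_pos_pos add_nonneg_pos) auto
    then show ?thesis by (simp add: q)
  qed
  have "(\<lambda>n. \<integral>\<^sup>+ x. ennreal (q n x) \<partial>\<mu>) \<longlonglongrightarrow> (\<integral>\<^sup>+ x. 1 \<partial>\<mu>)"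
  proof (rule nn_integral_LIMSEQ)
    show "incseq (\<lambda>n x. ennreal (q n x))"
      using q_mono by (auto simp: incseq_def le_fun_def intro!: ennreal_leI)
    show "(\<lambda>x. ennreal (q n x)) \<in> borel_measurable \<mu>" for n
      unfolding q_def by measurable
    show "(\<lambda>n. ennreal (q n x)) \<longlonglongrightarrow> 1" for x
      using tendsto_ennrealI[OF q_lim[of x]] by simp
  qed
  then have lim: "(\<lambda>n. \<integral>\<^sup>+ x. ennreal (q n x) \<partial>\<mu>) \<longlonglongrightarrow> \<infinity>"
    using assms by simp
  have eq: "(\<integral>\<^sup>+ x. ennreal (q n x) \<partial>\<mu>) =
      ennreal (real (Suc n) * Im (G (\<i> * complex_of_real (real (Suc n)))))" for n
  proof -
    have pos: "real (Suc n) > 0" by simp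
    have "integrable \<mu> (\<lambda>x. Im (Nevanlinna_kernel (\<i> * complex_of_real (real (Suc n))) x))"
      using integrable_Im[OF kernel_integrable] by simp
    then have "integrable \<mu> (\<lambda>x. real (Suc n) / (x\<^sup>2 + (real (Suc n))\<^sup>2))"
      by (simp only: Im_kernel_imaginary[OF pos])
    then have int: "integrable \<mu> (\<lambda>x. real (Suc n) * (real (Suc n) / (x\<^sup>2 + (real (Suc n))\<^sup>2)))"
      by (rule integrable_mult_right)
    moreover have qeq: "q n x = real (Suc n) * (real (Suc n) / (x\<^sup>2 + (real (Suc n))\<^sup>2))" for x
      by (simp add: q_def power2_eq_square)
    ultimately have "(\<integral>\<^sup>+ x. ennreal (q n x) \<partial>\<mu>) = ennreal (\<integral>x. q n x \<partial>\<mu>)"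
      by (intro nn_integral_eq_integral) (simp_all add: q_def)
    also have "(\<integral>x. q n x \<partial>\<mu>) = real (Suc n) * Im (G (\<i> * complex_of_real (real (Suc n))))"
      unfolding qeq Im_G_imaginary[OF pos] by (rule integral_mult_right_zero)
    finally show ?thesis .
  qed
  have "eventually (\<lambda>n. ennreal C < (\<integral>\<^sup>+ x. ennreal (q n x) \<partial>\<mu>)) sequentially"
    by (rule order_tendstoD(1)[OF lim]) simp
  then show ?thesis
    unfolding eq by eventually_elim (metis ennreal_leI linorder_not_le)
qed

text \<open>
  For \<open>y \<ge> 1\<close> the kernel at \<open>\<i> y\<close>, divided by \<open>y\<close>, is dominated by the weight
  \<open>1 / (1 + x\<^sup>2)\<close>, and it tends to zero pointwise.
\<close>

lemma G_sublinear:
  "(\<lambda>n. G (\<i> * complex_of_real (real (Suc n))) / complex_of_real (real (Suc n))) \<longlonglongrightarrow> 0"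
proof -
  define k where "k n x = Nevanlinna_kernel (\<i> * complex_of_real (real (Suc n))) x / complex_of_real (real (Suc n))" for n x
  have "(\<lambda>n. \<integral>x. k n x \<partial>\<mu>) \<longlonglongrightarrow> (\<integral>x. 0 \<partial>\<mu>)"
  proof (rule integral_dominated_convergence[OF _ _ weight_integrable])
    show "(\<lambda>x. 0) \<in> borel_measurable \<mu>" by simp
    show "k n \<in> borel_measurable \<mu>" for n unfolding k_def by measurable
    show "AE x in \<mu>. cmod (k n x) \<le> 1 / (1 + x\<^sup>2)" for n
    proof (rule AE_I2)
      fix x :: real
      define y where "y = real (Suc n)"
      have y: "y \<ge> 1" by (simp add: y_def)
      have "(cmod (1 + x * (\<i> * y)))\<^sup>2 \<le> (cmod (x - \<i> * y) * y)\<^sup>2"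
      proof -
        have "1\<^sup>2 \<le> y\<^sup>2" using y by (intro power_mono) auto
        then have "1 * 1 \<le> y\<^sup>2 * y\<^sup>2" by (intro mult_mono) auto
        then show ?thesis
          unfolding power_mult_distrib cmod_power2
          by (simp add: power_mult_distrib ring_distribs)
      qed
      then have "cmod (1 + x * (\<i> * y)) \<le> cmod (x - \<i> * y) * y"
        by (rule power2_le_imp_le) (use y in auto)
      moreover have "x - \<i> * y \<noteq> 0" using y by (simp add: complex_eq_iff)
      ultimately have "cmod ((1 + x * (\<i> * y)) / (x - \<i> * y) / y) \<le> 1"
        using y by (simp add: norm_divide norm_mult divide_le_eq)
      moreover have "cmod (complex_of_real (1 + x\<^sup>2)) = 1 + x\<^sup>2"
        using one_plus_square_pos[of x] unfolding norm_of_real by simp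
      moreover have "k n x = (1 + x * (\<i> * y)) / (x - \<i> * y) / y / complex_of_real (1 + x\<^sup>2)"
        using y Nevanlinna_kernel_eq[of "\<i> * complex_of_real y" x]
        unfolding k_def y_def[symmetric] by simp
      ultimately show "cmod (k n x) \<le> 1 / (1 + x\<^sup>2)"
        using one_plus_square_pos[of x] by (simp only: norm_divide divide_right_mono less_imp_le)
    qed
    show "AE x in \<mu>. (\<lambda>n. k n x) \<longlonglongrightarrow> 0"
    proof (rule AE_I2)
      fix x :: real
      have "(\<lambda>n. (1 + \<bar>x\<bar>) * inverse (real (Suc n))) \<longlonglongrightarrow> (1 + \<bar>x\<bar>) * 0"
        by (intro tendsto_intros LIMSEQ_inverse_real_of_nat)
      moreover have "cmod (k n x) \<le> (1 + \<bar>x\<bar>) * inverse (real (Suc n))" for n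
      proof -
        define y where "y = real (Suc n)"
        have y: "y \<ge> 1" by (simp add: y_def)
        have "1 \<le> cmod (x - \<i> * y)" using abs_Im_le_cmod[of "x - \<i> * y"] y by simp
        then have "cmod (1 / (complex_of_real x - \<i> * y)) \<le> 1" by (simp add: norm_divide divide_le_eq)
        moreover have "cmod (complex_of_real (x / (1 + x\<^sup>2))) \<le> \<bar>x\<bar>"
          unfolding norm_of_real using one_plus_square_pos[of x]
          by (simp add: divide_le_eq mult_le_cancel_left1)
        ultimately have "cmod (Nevanlinna_kernel (\<i> * y) x) \<le> 1 + \<bar>x\<bar>"
          unfolding Nevanlinna_kernel_def using norm_triangle_ineq4 add_mono order_trans by metis
        then show ?thesis
          using y unfolding k_def y_def[symmetric]
          by (simp add: norm_divide divide_inverse[symmetric] divide_right_mono)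
      qed
      ultimately show "(\<lambda>n. k n x) \<longlonglongrightarrow> 0"
        by (intro Lim_null_comparison[of "\<lambda>n. k n x" "\<lambda>n. (1 + \<bar>x\<bar>) * inverse (real (Suc n))"]) auto
    qed
  qed
  then show ?thesis by (simp add: k_def)
qed

text \<open>
  For a finite measure the two terms of the kernel are integrable separately: the second one contributes
  the real constant \<open>c\<close>, the first one decays like \<open>1 / y\<close>.
\<close>

lemma finite_measure_asymptotics:
  assumes "emeasure \<mu> UNIV \<noteq> \<infinity>"
  obtains c m :: real where "m \<ge> 0"
    and "\<And>y. y > 0 \<Longrightarrow> cmod (G (\<i> * complex_of_real y) - c) \<le> m / y"
proof
  interpret finite_measure \<mu> using assms by (intro finite_measureI) simp
  show "measure \<mu> UNIV \<ge> 0" by simp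
  fix y :: real assume y: "y > 0"
  have bound: "cmod (1 / (complex_of_real x - \<i> * y)) \<le> 1 / y" for x
  proof -
    have "y \<le> cmod (x - \<i> * y)" using abs_Im_le_cmod[of "x - \<i> * y"] y by simp
    then show ?thesis using y by (simp add: norm_divide frac_le)
  qed
  have int1: "integrable \<mu> (\<lambda>x. 1 / (complex_of_real x - \<i> * y))"
    by (rule integrable_const_bound[where B = "1 / y"]) (use bound in auto)
  have int2: "integrable \<mu> (\<lambda>x. x / (1 + x\<^sup>2))"
  proof (rule integrable_const_bound[where B = 1])
    have "\<bar>x\<bar> \<le> 1 + x\<^sup>2" for x :: real
    proof -
      have "0 \<le> (\<bar>x\<bar> - 1)\<^sup>2 + x\<^sup>2 + 1" by simp
      then show ?thesis by (simp add: power2_eq_square algebra_simps)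
    qed
    then show "AE x in \<mu>. norm (x / (1 + x\<^sup>2)) \<le> 1"
      using one_plus_square_pos by (intro AE_I2) (simp add: divide_le_eq abs_of_pos)
  qed simp
  have "G (\<i> * y) = (\<integral>x. 1 / (complex_of_real x - \<i> * y) \<partial>\<mu>) - complex_of_real (\<integral>x. x / (1 + x\<^sup>2) \<partial>\<mu>)"
    unfolding Nevanlinna_kernel_def
    by (subst Bochner_Integration.integral_diff[OF int1]) (use int2 in \<open>auto simp del: of_real_divide\<close>)
  then have "G (\<i> * y) - complex_of_real (- (\<integral>x. x / (1 + x\<^sup>2) \<partial>\<mu>)) = (\<integral>x. 1 / (complex_of_real x - \<i> * y) \<partial>\<mu>)"
    by simp
  moreover have "cmod (\<integral>x. 1 / (complex_of_real x - \<i> * y) \<partial>\<mu>) \<le> (\<integral>x. 1 / y \<partial>\<mu>)"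
    by (rule Bochner_Integration.integral_norm_bound_integral[OF int1]) (use bound in auto)
  ultimately show "cmod (G (\<i> * y) - complex_of_real (- (\<integral>x. x / (1 + x\<^sup>2) \<partial>\<mu>))) \<le> measure \<mu> UNIV / y"
    by simp
qed

end

section \<open>Moebius transformations of impedance functions\<close>

lemma class_MQ_iff:
  "V \<in> class_MQ Q \<kappa> \<longleftrightarrow> herglotz_nevanlinna V \<and>
     (\<exists>\<mu>. Nevanlinna_measure \<mu> ((1 - \<kappa>) / (1 + \<kappa>)) \<and> emeasure \<mu> UNIV = \<infinity> \<and>
       (\<forall>z. Im z > 0 \<longrightarrow> V z = complex_of_real Q + (\<integral>x. Nevanlinna_kernel z x \<partial>\<mu>)))"
  unfolding class_MQ_def Nevanlinna_measure_def Nevanlinna_kernel_def by auto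

lemma class_MQ_at_i:
  assumes "V \<in> class_MQ Q \<kappa>" and "0 \<le> (1 - \<kappa>) / (1 + \<kappa>)"
  shows "V \<i> = Complex Q ((1 - \<kappa>) / (1 + \<kappa>))"
proof -
  obtain \<mu> where \<mu>: "Nevanlinna_measure \<mu> ((1 - \<kappa>) / (1 + \<kappa>))"
    and "V \<i> = complex_of_real Q + (\<integral>x. Nevanlinna_kernel \<i> x \<partial>\<mu>)"
    using assms(1) by (auto simp: class_MQ_iff)
  then show ?thesis
    using Nevanlinna_measure.G_at_i[OF \<mu> assms(2)] by (simp add: Complex_eq)
qed

text \<open>
  Write \<open>V' = - t + (1 + t\<^sup>2) / (t - V)\<close>. This is again a Herglotz function, so it has a
  representation with a linear coefficient \<open>L\<close> and a measure \<open>\<nu>\<close>; what has to be shown is that the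
  class is not left, that is \<open>L = 0\<close> and \<open>\<nu>\<close> is infinite. Both follow from the behaviour of \<open>V\<close> along
  the imaginary axis, where \<open>y * Im (V (\<i> y))\<close> tends to infinity (the measure of \<open>V\<close> is infinite) and
  \<open>V (\<i> y) / y\<close> tends to zero (\<open>V\<close> has no linear term).
\<close>

theorem Moebius_class_MQ:
  fixes V V' :: "complex \<Rightarrow> complex" and t :: real
  assumes V: "V \<in> class_MQ Q \<kappa>"
    and V': "\<And>z. Im z > 0 \<Longrightarrow> V' z = (1 + t * V z) / (t - V z)"
    and norm: "Im (V' \<i>) = (1 - \<kappa>) / (1 + \<kappa>)"
  shows "V' \<in> class_MQ (Re (V' \<i>)) \<kappa>"
proof -
  define r where "r = 1 + t\<^sup>2"
  have r: "r > 0" unfolding r_def by (rule one_plus_square_pos)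
  obtain \<mu> where \<mu>: "Nevanlinna_measure \<mu> ((1 - \<kappa>) / (1 + \<kappa>))" and inf: "emeasure \<mu> UNIV = \<infinity>"
    and V_rep: "\<And>z::complex. Im z > 0 \<Longrightarrow> V z = complex_of_real Q + (\<integral>x. Nevanlinna_kernel z x \<partial>\<mu>)"
    using V by (auto simp: class_MQ_iff)
  interpret M: Nevanlinna_measure \<mu> "(1 - \<kappa>) / (1 + \<kappa>)" by (rule \<mu>)
  have hol: "V holomorphic_on {z. Im z > 0}" and pos: "\<And>z. Im z > 0 \<Longrightarrow> Im (V z) > 0"
    using V by (auto simp: class_MQ_def herglotz_nevanlinna_def)
  have nz: "t - V z \<noteq> 0" if "Im z > 0" for z
    using pos[OF that] by (auto simp: complex_eq_iff)
  have shift: "V' z + t = complex_of_real r / (t - V z)" if "Im z > 0" for z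
    using nz[OF that] V'[OF that] by (simp add: r_def field_simps power2_eq_square)
  have ImV': "Im (V' z) = r * Im (V z) / (cmod (t - V z))\<^sup>2" if "Im z > 0" for z
  proof -
    have "Im (V' z) = Im (complex_of_real r / (t - V z))"
      using arg_cong[OF shift[OF that], of Im] by simp
    then show ?thesis by (simp add: Im_divide cmod_power2)
  qed
  have herg: "herglotz_nevanlinna V'"
    unfolding herglotz_nevanlinna_def
  proof (intro conjI allI impI)
    have "(\<lambda>z. (1 + t * V z) / (t - V z)) holomorphic_on {z. Im z > 0}"
      using nz by (intro holomorphic_intros hol) auto
    then show "V' holomorphic_on {z. Im z > 0}"
      using V' by (subst holomorphic_cong[OF refl]) auto
    show "Im (V' z) > 0" if "Im z > 0" for z
      unfolding ImV'[OF that] using r pos[OF that] nz[OF that] by simp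
  qed
  obtain L \<nu> where L: "0 \<le> L" "L \<le> Im (V' \<i>)" and sets: "sets \<nu> = sets borel"
    and weight: "(\<integral>\<^sup>+ x. ennreal (1 / (1 + x\<^sup>2)) \<partial>\<nu>) = ennreal (Im (V' \<i>) - L)"
    and V'_rep: "\<And>z::complex. Im z > 0 \<Longrightarrow> V' z = Re (V' \<i>) + L * z + (\<integral>x. Nevanlinna_kernel z x \<partial>\<nu>)"
    using Nevanlinna_representation[OF herg] by metis
  interpret N: Nevanlinna_measure \<nu> "Im (V' \<i>) - L"
    by unfold_locales (rule sets, rule weight)
  have growth: "eventually (\<lambda>n. C < real (Suc n) * Im (V (\<i> * complex_of_real (real (Suc n))))) sequentially" for C
    using M.imaginary_part_growth[OF inf, of C] by (simp add: V_rep)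
  \<comment> \<open>If \<open>L > 0\<close>, then \<open>L y \<le> Im (V' (\<i> y)) \<le> r / Im (V (\<i> y))\<close> would bound \<open>y * Im (V (\<i> y))\<close>.\<close>
  have L0: "L = 0"
  proof (rule ccontr)
    assume "L \<noteq> 0"
    then have Lp: "L > 0" using L by simp
    obtain n where n: "r / L < real (Suc n) * Im (V (\<i> * complex_of_real (real (Suc n))))"
      using eventually_happens[OF growth[of "r / L"]] by auto
    define y where "y = real (Suc n)"
    define z where "z = \<i> * complex_of_real y"
    have y: "y > 0" and z: "Im z > 0" by (simp_all add: y_def z_def)
    have "L * y \<le> Im (V' z)"
      using arg_cong[OF V'_rep[OF z], of Im] N.Im_G_nonneg[OF y] by (simp add: z_def)
    also have "\<dots> \<le> r * Im (V z) / (Im (V z))\<^sup>2"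
    proof -
      have "(Im (V z))\<^sup>2 \<le> (cmod (t - V z))\<^sup>2" by (simp add: cmod_power2)
      then show ?thesis
        unfolding ImV'[OF z] using pos[OF z] r nz[OF z] by (intro divide_left_mono) auto
    qed
    also have "\<dots> = r / Im (V z)" by (simp add: power2_eq_square)
    finally have "L * y * Im (V z) \<le> r" using pos[OF z] by (simp add: le_divide_eq)
    moreover have "r < L * (y * Im (V z))"
      using n Lp unfolding y_def[symmetric] z_def[symmetric]
      by (simp add: divide_less_eq mult.commute)
    ultimately show False by (simp add: mult.assoc)
  qed
  have inf': "emeasure \<nu> UNIV = \<infinity>"
  proof (rule ccontr)
    assume fin: "emeasure \<nu> UNIV \<noteq> \<infinity>"
    obtain c m :: real where m: "m \<ge> 0"
      and cm: "\<And>y. y > 0 \<Longrightarrow> cmod (N.G (\<i> * complex_of_real y) - c) \<le> m / y"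
      by (rule N.finite_measure_asymptotics[OF fin]) (rule that)
    \<comment> \<open>For finite \<open>\<nu>\<close>, \<open>V' + t\<close> is within \<open>m / y\<close> of the real number \<open>d\<close> on the imaginary axis.
      If \<open>d = 0\<close>, then \<open>t - V = r / (V' + t)\<close> grows at least linearly; if \<open>d \<noteq> 0\<close>, then \<open>t - V\<close>
      stays bounded and \<open>Im V\<close> is \<open>O(1 / y)\<close>.\<close>
    define d where "d = Re (V' \<i>) + c + t"
    have close: "cmod (V' (\<i> * complex_of_real y) + t - d) \<le> m / y" if "y > 0" for y
      using cm[OF that] V'_rep[of "\<i> * complex_of_real y"] that
      by (simp add: d_def L0 algebra_simps)
    show False
    proof (cases "d = 0")
      case True
      have "(\<lambda>n. complex_of_real (t - Q) * complex_of_real (inverse (real (Suc n))) -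
          M.G (\<i> * complex_of_real (real (Suc n))) / complex_of_real (real (Suc n)))
          \<longlonglongrightarrow> complex_of_real (t - Q) * complex_of_real 0 - 0"
        by (rule tendsto_diff[OF tendsto_mult[OF tendsto_const
                tendsto_of_real[OF LIMSEQ_inverse_real_of_nat]] M.G_sublinear])
      then have lim: "(\<lambda>n. m * cmod (complex_of_real (t - Q) * complex_of_real (inverse (real (Suc n))) -
          M.G (\<i> * complex_of_real (real (Suc n))) / complex_of_real (real (Suc n)))) \<longlonglongrightarrow> m * cmod (complex_of_real (t - Q) * complex_of_real 0 - 0)"
        by (rule tendsto_mult[OF tendsto_const tendsto_norm])
      have "eventually (\<lambda>n. m * cmod (complex_of_real (t - Q) * complex_of_real (inverse (real (Suc n))) -
          M.G (\<i> * complex_of_real (real (Suc n))) / complex_of_real (real (Suc n))) < r) sequentially"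
        by (rule order_tendstoD(2)[OF lim]) (use r in simp)
      then obtain n where n: "m * cmod (complex_of_real (t - Q) * complex_of_real (inverse (real (Suc n))) -
          M.G (\<i> * complex_of_real (real (Suc n))) / complex_of_real (real (Suc n))) < r"
        using eventually_happens'[OF sequentially_bot] by blast
      define y where "y = real (Suc n)"
      define z where "z = \<i> * complex_of_real y"
      have y: "y > 0" and z: "Im z > 0" by (simp_all add: y_def z_def)
      have "r / cmod (t - V z) \<le> m / y"
        using close[OF y] shift[OF z] r True
        by (simp add: norm_divide abs_of_pos flip: z_def)
      then have "r * y \<le> m * cmod (t - V z)"
        using y nz[OF z] by (simp add: field_simps)
      moreover have "m * cmod (t - V z) < r * y"
      proof -
        have "(t - V z) / y = complex_of_real (t - Q) * complex_of_real (inverse y) - M.G z / y"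
          by (simp add: V_rep[OF z] divide_inverse ring_distribs)
        then have "m * (cmod (t - V z) / y) < r"
        proof -
          have "cmod (t - V z) / y = cmod ((t - V z) / y)" using y by (simp add: norm_divide)
          then show ?thesis
            using n \<open>(t - V z) / y = _\<close> unfolding y_def[symmetric] z_def[symmetric] by simp
        qed
        then show ?thesis using y by (simp add: divide_less_eq)
      qed
      ultimately show False by simp
    next
      case False
      define C where "C = 4 * r * m / d\<^sup>2"
      have "eventually (\<lambda>n. 2 * m / \<bar>d\<bar> \<le> real n) sequentially"
        by (rule eventually_sequentiallyI[of "nat \<lceil>2 * m / \<bar>d\<bar>\<rceil>"]) linarith
      with growth[of C] have "eventually (\<lambda>n. C < real (Suc n) * Im (V (\<i> * complex_of_real (real (Suc n))))
          \<and> 2 * m / \<bar>d\<bar> \<le> real n) sequentially"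
        by (rule eventually_conj)
      then obtain n where n: "C < real (Suc n) * Im (V (\<i> * complex_of_real (real (Suc n))))"
        and n': "2 * m / \<bar>d\<bar> \<le> real n"
        using eventually_happens'[OF sequentially_bot] by blast
      define y where "y = real (Suc n)"
      define z where "z = \<i> * complex_of_real y"
      have y: "y > 0" "2 * m / \<bar>d\<bar> \<le> y" and z: "Im z > 0" using n' by (simp_all add: y_def z_def)
      have dist: "cmod (V' z + t - d) \<le> m / y" using close[OF y(1)] by (simp add: z_def)
      have "m / y \<le> \<bar>d\<bar> / 2" using y False by (simp add: field_simps)
      then have low: "\<bar>d\<bar> / 2 \<le> cmod (V' z + t)"
      proof -
        have "cmod (complex_of_real d) \<le> cmod (V' z + t) + cmod (V' z + t - d)"
          using norm_triangle_ineq4[of "V' z + t" "V' z + t - d"] by simp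
        then show ?thesis using dist \<open>m / y \<le> \<bar>d\<bar> / 2\<close> unfolding norm_of_real by linarith
      qed
      have up: "Im (V' z) \<le> m / y"
        using dist abs_Im_le_cmod[of "V' z + t - d"] by simp
      have "cmod (t - V z) = r / cmod (V' z + t)"
        using shift[OF z] r nz[OF z] by (simp add: norm_divide abs_of_pos)
      also have "\<dots> \<le> r / (\<bar>d\<bar> / 2)"
        using low False r by (intro divide_left_mono mult_pos_pos) auto
      finally have "(cmod (t - V z))\<^sup>2 \<le> (r / (\<bar>d\<bar> / 2))\<^sup>2" by (rule power_mono) simp
      then have dist2: "(cmod (t - V z))\<^sup>2 \<le> 4 * r\<^sup>2 / d\<^sup>2"
      proof -
        have "(r / (\<bar>d\<bar> / 2))\<^sup>2 = 4 * r\<^sup>2 / d\<^sup>2"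
          by (simp add: power2_eq_square mult.commute)
        then show ?thesis using \<open>_ \<le> (r / (\<bar>d\<bar> / 2))\<^sup>2\<close> by simp
      qed
      have "r * Im (V z) = Im (V' z) * (cmod (t - V z))\<^sup>2"
        unfolding ImV'[OF z] using nz[OF z] by simp
      also have "\<dots> \<le> m / y * (4 * r\<^sup>2 / d\<^sup>2)"
        using up dist2 m y by (intro mult_mono) auto
      also have "\<dots> = r * (C / y)" by (simp add: C_def power2_eq_square mult_ac)
      finally have "Im (V z) \<le> C / y" by (rule mult_left_le_imp_le) (rule r)
      then have "y * Im (V z) \<le> C" using y(1) by (simp add: le_divide_eq mult.commute)
      then show False using n unfolding y_def[symmetric] z_def[symmetric] by simp
    qed
  qed
  have "Nevanlinna_measure \<nu> ((1 - \<kappa>) / (1 + \<kappa>))"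
    using N.Nevanlinna_measure_axioms by (simp add: L0 norm)
  moreover have "\<forall>z. Im z > 0 \<longrightarrow>
      V' z = complex_of_real (Re (V' \<i>)) + (\<integral>x. Nevanlinna_kernel z x \<partial>\<nu>)"
  proof (intro allI impI)
    fix z :: complex assume "Im z > 0"
    from V'_rep[OF this] show "V' z = complex_of_real (Re (V' \<i>)) + (\<integral>x. Nevanlinna_kernel z x \<partial>\<nu>)"
      unfolding L0 of_real_0 mult_zero_left add_0_right .
  qed
  ultimately show ?thesis
    unfolding class_MQ_iff using herg inf' by (intro conjI exI[of _ \<nu>])
qed

text \<open>
  With \<open>p = cos \<alpha>\<close> and \<open>q = sin \<alpha>\<close> the factor is \<open>- (p + \<i> q)\<^sup>2\<close>; multiplying the relation by
  \<open>p - \<i> q\<close> makes it symmetric and leaves \<open>V' (q - p V) = p + q V\<close>.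
\<close>

lemma Moebius_of_unimodular:
  fixes V V' W W' :: complex
  assumes W: "W = (1 - \<i> * V) / (1 + \<i> * V)" "1 + \<i> * V \<noteq> 0"
    and W': "W' = (1 - \<i> * V') / (1 + \<i> * V')" "1 + \<i> * V' \<noteq> 0"
    and eq: "W' = W * (- exp (2 * \<i> * complex_of_real \<alpha>))" and c: "cos \<alpha> \<noteq> 0"
  shows "V' * (complex_of_real (tan \<alpha>) - V) = 1 + complex_of_real (tan \<alpha>) * V"
proof -
  define p q where "p = complex_of_real (cos \<alpha>)" and "q = complex_of_real (sin \<alpha>)"
  have pq: "(p + \<i> * q) * (p - \<i> * q) = 1"
    using sin_cos_squared_add3[of \<alpha>]
    by (simp add: p_def q_def algebra_simps flip: of_real_mult of_real_add)
  have E: "exp (2 * \<i> * complex_of_real \<alpha>) = (p + \<i> * q) * (p + \<i> * q)"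
    using cis_conv_exp[of \<alpha>] exp_add[of "\<i> * complex_of_real \<alpha>" "\<i> * complex_of_real \<alpha>"]
    by (simp add: p_def q_def cis.code Complex_eq mult.assoc)
  have "(1 - \<i> * V') * (1 + \<i> * V) = - ((p + \<i> * q) * (p + \<i> * q)) * (1 - \<i> * V) * (1 + \<i> * V')"
    using eq W(2) W'(2) unfolding W(1) W'(1) E by (simp add: field_simps)
  then have "(p - \<i> * q) * ((1 - \<i> * V') * (1 + \<i> * V)) =
      - ((p + \<i> * q) * (p - \<i> * q)) * ((p + \<i> * q) * (1 - \<i> * V) * (1 + \<i> * V'))"
    by algebra
  then have "(p - \<i> * q) * ((1 - \<i> * V') * (1 + \<i> * V)) = - ((p + \<i> * q) * (1 - \<i> * V) * (1 + \<i> * V'))"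
    by (simp only: pq) simp
  then have "2 * (V' * (q - p * V)) = 2 * (p + q * V)"
    by (simp add: algebra_simps)
  then have "V' * (q - p * V) = p + q * V" by (simp only: mult_cancel_left) simp
  moreover have "q = p * complex_of_real (tan \<alpha>)"
    unfolding p_def q_def of_real_mult[symmetric] using c by (simp add: tan_def)
  ultimately have "p * (V' * (complex_of_real (tan \<alpha>) - V)) = p * (1 + complex_of_real (tan \<alpha>) * V)"
    by (simp only: ring_distribs mult_1_right mult_1_left mult_ac)
  moreover have "p \<noteq> 0" using c by (simp add: p_def)
  ultimately show ?thesis by (simp only: mult_cancel_left) simp
qed

text \<open>
  The comparison is made in the lower half-plane, all of which belongs to both resolvent sets; in the upper
  half-plane the main operators may have spectrum. The symmetry of impedance functions under
  conjugation then transports the relation to the upper half-plane.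
\<close>

lemma impedance_unimodular_transformation:
  fixes \<Theta> :: "'a::chilbert_space l_system" and \<Theta>' :: "'b::chilbert_space l_system"
  assumes \<Theta>: "is_L_system \<Theta>" and \<Theta>': "unimodular_transformation \<alpha> \<Theta> \<Theta>'"
    and c: "cos \<alpha> \<noteq> 0" and z: "Im z > 0"
  shows "impedance_fun \<Theta>' z * (complex_of_real (tan \<alpha>) - impedance_fun \<Theta> z) =
    1 + complex_of_real (tan \<alpha>) * impedance_fun \<Theta> z"
proof -
  interpret A: L_system \<Theta> by unfold_locales (rule \<Theta>)
  interpret B: L_system \<Theta>' by unfold_locales (use \<Theta>' in \<open>simp add: unimodular_transformation_def\<close>)
  define w where "w = cnj z"
  have w: "Im w < 0" "Im w \<noteq> 0" using z by (simp_all add: w_def)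
  have "impedance_fun \<Theta>' w * (complex_of_real (tan \<alpha>) - impedance_fun \<Theta> w) =
      1 + complex_of_real (tan \<alpha>) * impedance_fun \<Theta> w"
  proof (rule Moebius_of_unimodular)
    show "transfer_fun \<Theta>' w = transfer_fun \<Theta> w * (- exp (2 * \<i> * complex_of_real \<alpha>))"
      using \<Theta>' A.lower_half_plane_resolvent[OF w(1)] B.lower_half_plane_resolvent[OF w(1)]
      by (simp add: unimodular_transformation_def)
  qed (use A.transfer_lower_half_plane B.transfer_lower_half_plane
      A.one_plus_i_impedance_nonzero B.one_plus_i_impedance_nonzero w c in auto)
  from arg_cong[OF this, of cnj] show ?thesis
    using A.impedance_cnj[OF w(2)] B.impedance_cnj[OF w(2)]
    unfolding w_def complex_cnj_mult complex_cnj_diff complex_cnj_add complex_cnj_complex_of_real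
      complex_cnj_cnj complex_cnj_one
    by metis
qed

theorem theorem10:
  fixes \<kappa> Q \<alpha> a b :: real
    and \<Theta> :: "('a::chilbert_space) l_system"
    and \<Theta>\<^sub>\<alpha> :: "('b::chilbert_space) l_system"
  assumes "0 \<le> \<kappa>" and "\<kappa> < 1" and "Q \<noteq> 0"
    and "minimal_L_system \<Theta>"
    and "impedance_fun \<Theta> \<in> class_MQ Q \<kappa>"
    and "0 \<le> \<alpha>" and "\<alpha> < pi" and "\<alpha> \<noteq> pi / 2"
    and "unimodular_transformation \<alpha> \<Theta> \<Theta>\<^sub>\<alpha>"
    and "a = (1 - \<kappa>) / (1 + \<kappa>)" and "b = Q\<^sup>2 + a\<^sup>2 - 1"
  shows "impedance_fun \<Theta>\<^sub>\<alpha> \<in> class_MQ (- Q) \<kappa> \<longleftrightarrow> tan \<alpha> = b / (2 * Q)"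
proof -
  let ?V = "impedance_fun \<Theta>" and ?V' = "impedance_fun \<Theta>\<^sub>\<alpha>"
  define t where "t = tan \<alpha>"
  have a: "a > 0" using assms(1,2,10) by simp
  have c: "cos \<alpha> \<noteq> 0"
    using assms(6-8) cos_inj_pi[of \<alpha> "pi / 2"] by auto
  have moeb: "?V' z * (t - ?V z) = 1 + t * ?V z" if "Im z > 0" for z
    using impedance_unimodular_transformation[OF _ assms(9) c that] assms(4)
    unfolding t_def by (simp add: minimal_L_system_def)
  have nz: "t - ?V z \<noteq> 0" if "Im z > 0" for z
    using assms(5) that by (auto simp: class_MQ_def herglotz_nevanlinna_def complex_eq_iff)
  have V': "?V' z = (1 + t * ?V z) / (t - ?V z)" if "Im z > 0" for z
    using moeb[OF that] nz[OF that] by (simp add: eq_divide_eq)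
  have Vi: "?V \<i> = Complex Q a"
    using class_MQ_at_i[OF assms(5)] a assms(10) by simp
  \<comment> \<open>Clearing denominators at \<open>\<i>\<close>, the imaginary parts agree identically and the real parts
    leave \<open>1 + t Q = Q\<^sup>2 + a\<^sup>2 - t Q\<close>.\<close>
  have value_eq: "?V' \<i> = Complex (- Q) a \<longleftrightarrow> tan \<alpha> = b / (2 * Q)"
  proof -
    have "?V' \<i> = Complex (- Q) a \<longleftrightarrow>
        Complex (- Q) a * (t - ?V \<i>) = 1 + t * ?V \<i>"
    proof -
      have "?V' \<i> = (1 + t * ?V \<i>) / (t - ?V \<i>)" and "t - ?V \<i> \<noteq> 0"
        using V'[of \<i>] nz[of \<i>] by simp_all
      then show ?thesis by (simp only: divide_eq_eq) auto
    qed
    also have "\<dots> \<longleftrightarrow> 2 * Q * t = b"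
      by (auto simp: Vi complex_eq_iff assms(11) power2_eq_square algebra_simps)
    also have "\<dots> \<longleftrightarrow> tan \<alpha> = b / (2 * Q)"
      using assms(3) by (auto simp: t_def field_simps)
    finally show ?thesis .
  qed
  show ?thesis
  proof
    assume "?V' \<in> class_MQ (- Q) \<kappa>"
    then show "tan \<alpha> = b / (2 * Q)"
      using class_MQ_at_i[of ?V' "- Q"] a assms(10) value_eq by simp
  next
    assume "tan \<alpha> = b / (2 * Q)"
    then have "?V' \<i> = Complex (- Q) a" using value_eq by simp
    then show "?V' \<in> class_MQ (- Q) \<kappa>"
      using Moebius_class_MQ[OF assms(5) V'] assms(10) by simp
  qed
qed

end
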